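(* Let $G$ be an unweighted digraph without loops, let $0\le\omega<1$ and $\tau=1-\omega$, and let $M_\tau(t)=I-At+(D-\tau I)\tau t^2+(A-S)\tau^2t^3$. Let $\mu$, $0<\mu\le1/\tau$, be the smallest positive real eigenvalue of $M_\tau(t)$, and let $r$ be the radius of convergence of $\sum_{k=0}^\infty t^kq_k(A,\omega)$ (which equals $(1-\tau^2t^2)M_\tau(t)^{-1}$ near $t=0$). Let $H_1,\dots,H_s$ be the undirectizations of the strongly connected or single node components of $G$. If some $H_i$ has more than one cycle, then $\mu=r<1/\tau$.
   Context: $G=(V,E)$, adjacency matrix $A$, $S=A\circ A^T$, $D=\mathrm{diag}(\mathrm{diag}(A^2))$. A walk $(v_1,\dots,v_{k+1})$ of length $k$ backtracks at position $r$ if $v_{r+2}=v_r$; $q_k(A,\omega)$ is the $n\times n$ matrix whose $(i,j)$ entry is $\sum \omega^{m(w)}$ over all walks $w$ of length $k$ from $i$ to $j$, where $m(w)$ is the number of backtracking positions of $w$ ($q_0=I$). Components: induced subgraphs on classes of "$i=j$ or mutually reachable". Undirectization: undirected simple graph with edge $\{i,j\}$ whenever $(i,j)$ or $(j,i)\in E$; a cycle is a closed path of length $\ge3$ up to cyclic permutations and reversal. *)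

theory Defs
  imports "HOL-Analysis.Analysis"
begin

text \<open>A digraph is an edge relation E on a finite vertex type 'n.\<close>

definition adjm :: "('n::finite \<times> 'n) set \<Rightarrow> real^'n^'n" where
  "adjm E = (\<chi> i j. if (i, j) \<in> E then 1 else 0)"

definition Smat :: "('n::finite \<times> 'n) set \<Rightarrow> real^'n^'n" where
  "Smat E = (\<chi> i j. adjm E $ i $ j * adjm E $ j $ i)"

definition Dmat :: "('n::finite \<times> 'n) set \<Rightarrow> real^'n^'n" where
  "Dmat E = (\<chi> i j. if i = j then (adjm E ** adjm E) $ i $ i else 0)"

text \<open>M_tau(t) = I - A t + (D - tau I) tau t^2 + (A - S) tau^2 t^3\<close>
definition Mtau :: "('n::finite \<times> 'n) set \<Rightarrow> real \<Rightarrow> real \<Rightarrow> real^'n^'n" where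
  "Mtau E \<tau> t = mat 1 - t *\<^sub>R adjm E + (\<tau> * t^2) *\<^sub>R (Dmat E - \<tau> *\<^sub>R mat 1)
                 + (\<tau>^2 * t^3) *\<^sub>R (adjm E - Smat E)"

text \<open>Walks of length k from i to j: vertex lists (v_1,...,v_{k+1}).\<close>
definition walks :: "('n \<times> 'n) set \<Rightarrow> nat \<Rightarrow> 'n \<Rightarrow> 'n \<Rightarrow> 'n list set" where
  "walks E k i j = {w. length w = Suc k \<and> w ! 0 = i \<and> w ! k = j \<and>
                       (\<forall>r<k. (w ! r, w ! Suc r) \<in> E)}"

text \<open>number of backtracking positions: v_{r+2} = v_r\<close>
definition nbacktrack :: "'n list \<Rightarrow> nat" where
  "nbacktrack w = card {r. Suc (Suc r) < length w \<and> w ! Suc (Suc r) = w ! r}"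

definition qmat :: "('n::finite \<times> 'n) set \<Rightarrow> real \<Rightarrow> nat \<Rightarrow> real^'n^'n" where
  "qmat E \<omega> k = (\<chi> i j. \<Sum>w\<in>walks E k i j. \<omega> ^ nbacktrack w)"

text \<open>Components: classes of "i = j or mutually reachable".\<close>
definition comp_rel :: "('n \<times> 'n) set \<Rightarrow> ('n \<times> 'n) set" where
  "comp_rel E = {(i, j). i = j \<or> ((i, j) \<in> E\<^sup>* \<and> (j, i) \<in> E\<^sup>*)}"

definition components :: "('n \<times> 'n) set \<Rightarrow> 'n set set" where
  "components E = UNIV // comp_rel E"

text \<open>Undirectization of the subgraph induced on C.\<close>
definition und_adj :: "('n \<times> 'n) set \<Rightarrow> 'n set \<Rightarrow> 'n \<Rightarrow> 'n \<Rightarrow> bool" where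
  "und_adj E C x y \<longleftrightarrow> x \<in> C \<and> y \<in> C \<and> x \<noteq> y \<and> ((x, y) \<in> E \<or> (y, x) \<in> E)"

text \<open>A closed path of length \<ge> 3 given by its vertex list.\<close>
definition is_cycle :: "('n \<Rightarrow> 'n \<Rightarrow> bool) \<Rightarrow> 'n list \<Rightarrow> bool" where
  "is_cycle U xs \<longleftrightarrow> length xs \<ge> 3 \<and> distinct xs \<and>
     (\<forall>r. Suc r < length xs \<longrightarrow> U (xs ! r) (xs ! Suc r)) \<and> U (last xs) (hd xs)"

text \<open>Cycles are identified up to cyclic permutation and reversal.\<close>
definition cycle_equiv :: "'n list \<Rightarrow> 'n list \<Rightarrow> bool" where
  "cycle_equiv xs ys \<longleftrightarrow> (\<exists>m. ys = rotate m xs \<or> ys = rotate m (rev xs))"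

definition more_than_one_cycle :: "('n \<Rightarrow> 'n \<Rightarrow> bool) \<Rightarrow> bool" where
  "more_than_one_cycle U \<longleftrightarrow>
     (\<exists>c1 c2. is_cycle U c1 \<and> is_cycle U c2 \<and> \<not> cycle_equiv c1 c2)"

end

theory Submission
  imports Defs
begin

text \<open>
  The weighted number of walks ending with a given edge satisfies a linear recursion whose generating
  function shows both the identity Q(t) M(t) = (1 - tau^2 t^2) I inside the disc of convergence and
  a self-improvement: if the walk series converges at t > 0, then it converges beyond t. With Cramer's
  rule, the radius r is therefore a zero of det M as soon as r < 1 / tau, and the identity rules out
  smaller zeros.

  It remains to see r < 1. Call two edges consecutive if they form a walk of length two that does not
  backtrack. A strongly connected component whose undirectization has two cycles contains an edge with
  two different predecessors that can both be reached from it: its edges that are not bidirected lie on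
  directed cycles, and from two different cycles one obtains a non-backtracking excursion from a
  directed cycle to itself. For such an edge with return times a and b convergence at t < 1 forces
  t^(a+1) + t^(b+1) \<le> 1, which fails near 1, whatever the weight of a backtracking step.
\<close>

subsection \<open>Merging non-backtracking walks\<close>

text \<open>The support of the Hashimoto non-backtracking matrix, as a relation on directed
  edges.\<close>

definition nb_step :: "('n \<times> 'n) set \<Rightarrow> (('n \<times> 'n) \<times> ('n \<times> 'n)) set" where
  "nb_step E = {((x, y), (y', z)). y' = y \<and> (x, y) \<in> E \<and> (y, z) \<in> E \<and> z \<noteq> x}"

text \<open>Encodes two non-backtracking returns from \<open>e\<close> to itself that differ in
  their last step. Both predecessors contribute to the recursion at \<open>e\<close>, which forces
  exponential growth.\<close>

definition nb_merging :: "('n \<times> 'n) set \<Rightarrow> bool" where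
  "nb_merging E \<longleftrightarrow> (\<exists>e g1 g2. g1 \<noteq> g2 \<and> (g1, e) \<in> nb_step E \<and> (g2, e) \<in> nb_step E
      \<and> (e, g1) \<in> (nb_step E)\<^sup>* \<and> (e, g2) \<in> (nb_step E)\<^sup>*)"

section \<open>Cycles as periodic sequences\<close>

text \<open>A cycle is stored as a sequence of period \<open>m\<close>, so that going around it
  needs no wrap-around. No edge relation is built in: the same notion serves directed cycles of
  \<open>E\<close> and cycles of the undirectization.\<close>

definition periodic_cycle :: "nat \<Rightarrow> (nat \<Rightarrow> 'n) \<Rightarrow> bool" where
  "periodic_cycle m z \<longleftrightarrow> m \<ge> 3 \<and> inj_on z {..<m} \<and> (\<forall>k. z (k + m) = z k)"

definition on_cycle :: "(nat \<Rightarrow> 'n) \<Rightarrow> 'n \<Rightarrow> 'n \<Rightarrow> bool" where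
  "on_cycle z x y \<longleftrightarrow> (\<exists>k. (x = z k \<and> y = z (Suc k)) \<or> (x = z (Suc k) \<and> y = z k))"

lemma on_cycle_sym: "on_cycle z x y \<Longrightarrow> on_cycle z y x"
  unfolding on_cycle_def by blast

lemma periodic_cycle_mod:
  assumes "periodic_cycle m z" shows "z (k mod m) = z k"
proof -
  have "z (a + n * m) = z a" for a n
  proof (induction n)
    case (Suc n)
    have "z (a + Suc n * m) = z (a + n * m + m)" by (simp add: algebra_simps)
    also have "\<dots> = z (a + n * m)" using assms unfolding periodic_cycle_def by blast
    finally show ?case using Suc.IH by simp
  qed simp
  from this[of "k mod m" "k div m"] show ?thesis by simp
qed

lemma periodic_cycle_eq_iff:
  assumes "periodic_cycle m z" shows "z j = z k \<longleftrightarrow> j mod m = k mod m"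
proof
  assume "z j = z k"
  then have "z (j mod m) = z (k mod m)" using periodic_cycle_mod[OF assms] by simp
  moreover have "inj_on z {..<m}" "m > 0" using assms by (auto simp: periodic_cycle_def)
  ultimately show "j mod m = k mod m" by (auto dest!: inj_onD)
qed (metis periodic_cycle_mod[OF assms])

lemma periodic_cycle_shift:
  assumes "periodic_cycle m z" "z j = z k" shows "z (j + d) = z (k + d)"
  using assms(2) unfolding periodic_cycle_eq_iff[OF assms(1)] by (metis mod_add_left_eq)

text \<open>A shift by \<open>m - 1\<close> undoes a step, because the shift by \<open>m\<close> is
  the identity.\<close>

lemma periodic_cycle_Suc_cancel:
  assumes "periodic_cycle m z" "z (Suc j) = z (Suc k)" shows "z j = z k"
proof -
  have m: "m \<ge> 3" using assms(1) by (simp add: periodic_cycle_def)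
  have "z (Suc j + (m - 1)) = z (Suc k + (m - 1))"
    using periodic_cycle_shift[OF assms] .
  then have "z (j + m) = z (k + m)" using m by simp
  then show ?thesis using assms(1) by (simp add: periodic_cycle_def)
qed

text \<open>Going around a cycle never backtracks, because \<open>m >= 3\<close> does not divide
  2.\<close>

lemma periodic_cycle_neq_add2:
  assumes "periodic_cycle m z" shows "z k \<noteq> z (k + 2)"
proof
  have m: "m \<ge> 3" using assms by (simp add: periodic_cycle_def)
  assume "z k = z (k + 2)"
  \<comment> \<open>This shift moves index \<open>k\<close> to a multiple of \<open>m\<close>, which
    leaves only the residue of 2.\<close>
  from periodic_cycle_shift[OF assms this, of "m * k - k"] have "z (m * k) = z (m * k + 2)"
    using m by (simp add: algebra_simps)
  then have "(2 + m * k) mod m = 0" unfolding periodic_cycle_eq_iff[OF assms] by (simp add: add.commute)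
  then have "2 mod m = 0" by (simp only: mod_mult_self2)
  then show False using m by simp
qed

lemma periodic_cycle_reindex:
  assumes "periodic_cycle m z" "x \<in> range z" shows "\<exists>k\<ge>n. z k = x"
proof -
  obtain j where j: "x = z j" using assms by blast
  have "z (j + n * m) = z j" unfolding periodic_cycle_eq_iff[OF assms(1)] by simp
  moreover have "j + n * m \<ge> n" using assms(1) by (auto simp: periodic_cycle_def intro: trans_le_add2)
  ultimately show ?thesis using j by metis
qed

lemma periodic_cycle_pred:
  assumes "periodic_cycle m z" "x \<in> range z" shows "\<exists>k. x = z (Suc k)"
  using periodic_cycle_reindex[OF assms, of 1] by (metis One_nat_def Suc_le_D)

section \<open>Excursions from a directed cycle\<close>

lemma nb_walk:
  assumes "\<And>i. i < n \<Longrightarrow> (p i, p (Suc i)) \<in> E"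
    and "\<And>i. Suc (Suc i) \<le> n \<Longrightarrow> p (Suc (Suc i)) \<noteq> p i" and "n > 0"
  shows "((p 0, p 1), (p (n - 1), p n)) \<in> (nb_step E)\<^sup>*"
  using assms
proof (induction n)
  case (Suc n)
  show ?case
  proof (cases "n = 0")
    case False
    then obtain n' where n': "n = Suc n'" by (cases n) auto
    have "((p 0, p 1), (p (n - 1), p n)) \<in> (nb_step E)\<^sup>*" using Suc False by auto
    moreover have "((p (n - 1), p n), (p n, p (Suc n))) \<in> nb_step E"
      using Suc.prems(1)[of n'] Suc.prems(1)[of n] Suc.prems(2)[of n'] n'
      by (auto simp: nb_step_def)
    ultimately show ?thesis by simp
  qed simp
qed simp

lemma nb_cycle_reach:
  assumes z: "periodic_cycle m z" and E: "\<And>k. (z k, z (Suc k)) \<in> E"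
    and x: "x = z j" "y = z (Suc j)" "x' = z k" "y' = z (Suc k)"
  shows "((x, y), (x', y')) \<in> (nb_step E)\<^sup>*"
proof -
  \<comment> \<open>The target edge is met again at an index beyond \<open>j\<close>, so walking
    forward along \<open>z\<close> reaches it.\<close>
  obtain l where l: "l \<ge> j" "z l = z k" using periodic_cycle_reindex[OF z, of "z k" j] by auto
  have "z (Suc l) = z (Suc k)" using periodic_cycle_shift[OF z l(2), of 1] by simp
  moreover have "((z (j + 0), z (j + 1)), (z (j + (Suc (l - j) - 1)), z (j + Suc (l - j)))) \<in> (nb_step E)\<^sup>*"
    using nb_walk[where n = "Suc (l - j)" and p = "\<lambda>i. z (j + i)" and E = E] E
      periodic_cycle_neq_add2[OF z] by (simp add: numeral_2_eq_2) metis
  ultimately show ?thesis using l x by simp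
qed

text \<open>The merging edge is the cycle edge leaving \<open>y\<close>. Its predecessors are the
  cycle edge into \<open>y\<close>, reached by going around, and \<open>(u, y)\<close>, reached by
  going around to \<open>x\<close> and then taking the excursion.\<close>

lemma nb_merging_excursion:
  assumes z: "periodic_cycle m z" and E: "\<And>k. (z k, z (Suc k)) \<in> E"
    and x: "x \<in> range z" and y: "y \<in> range z"
    and off: "\<not> on_cycle z x v" "\<not> on_cycle z u y"
    and vE: "(x, v) \<in> E" and uE: "(u, y) \<in> E"
    and reach: "((x, v), (u, y)) \<in> (nb_step E)\<^sup>*"
  shows "nb_merging E"
proof -
  obtain k j where k: "x = z (Suc k)" and j: "y = z (Suc j)"
    using periodic_cycle_pred[OF z] x y by metis
  have nv: "v \<noteq> z k" using off(1) k unfolding on_cycle_def by auto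
  \<comment> \<open>The first inequality separates the two predecessors; the second keeps the return
    to the cycle from backtracking.\<close>
  have nu: "u \<noteq> z j" "u \<noteq> z (Suc (Suc j))" using off(2) j unfolding on_cycle_def by auto
  let ?e = "(y, z (Suc (Suc j)))"
  have "((z j, y), ?e) \<in> nb_step E"
    using E[of j] E[of "Suc j"] periodic_cycle_neq_add2[OF z, of j]
    by (auto simp: nb_step_def j numeral_2_eq_2)
  moreover have "((u, y), ?e) \<in> nb_step E"
    using nu uE E[of "Suc j"] by (auto simp: nb_step_def j)
  moreover have "(?e, (z j, y)) \<in> (nb_step E)\<^sup>*"
    by (rule nb_cycle_reach[OF z E j refl refl j])
  moreover have "(?e, (u, y)) \<in> (nb_step E)\<^sup>*"
  proof -
    have "(?e, (z k, x)) \<in> (nb_step E)\<^sup>*"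
      by (rule nb_cycle_reach[OF z E j refl refl k])
    moreover have "((z k, x), (x, v)) \<in> nb_step E"
      using E[of k] vE nv by (auto simp: nb_step_def k)
    ultimately show ?thesis using reach by (meson rtrancl.rtrancl_into_rtrancl rtrancl_trans)
  qed
  ultimately show ?thesis unfolding nb_merging_def using nu(1) by (metis fst_conv)
qed

text \<open>From the meeting point, \<open>c\<close> is followed to its first edge off
  \<open>z\<close> and from there to the next vertex of \<open>z\<close>. Only this stretch is
  walked, so the edges of \<open>c\<close> on \<open>z\<close> may point either way.\<close>

lemma nb_merging_meeting_cycle:
  assumes z: "periodic_cycle m z" and E: "\<And>k. (z k, z (Suc k)) \<in> E"
    and c: "periodic_cycle n c"
    and cE: "\<And>k. on_cycle z (c k) (c (Suc k)) \<or> (c k, c (Suc k)) \<in> E"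
    and meet: "c a \<in> range z" and off: "\<not> on_cycle z (c b) (c (Suc b))"
  shows "nb_merging E"
proof -
  have n: "n \<ge> 3" and per: "\<And>k. c (k + n) = c k" using c by (auto simp: periodic_cycle_def)
  define P where "P k \<longleftrightarrow> k \<ge> a \<and> \<not> on_cycle z (c k) (c (Suc k))" for k
  define k where "k = (LEAST k. P k)"
  \<comment> \<open>Adding \<open>a\<close> full rounds of \<open>c\<close> moves the edge at
    \<open>b\<close> to an index of at least \<open>a\<close>.\<close>
  have "P (b + a * n)"
  proof -
    have "c (b + a * n) = c b" unfolding periodic_cycle_eq_iff[OF c] by simp
    moreover from periodic_cycle_shift[OF c this, of 1] have "c (Suc (b + a * n)) = c (Suc b)" by simp
    ultimately show ?thesis using off n by (auto simp: P_def intro: trans_le_add2)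
  qed
  then have Pk: "P k" unfolding k_def by (rule LeastI)
  have ck: "c k \<in> range z"
  proof (cases "k = a")
    case False
    then obtain k' where k': "k = Suc k'" "k' \<ge> a" using Pk by (cases k) (auto simp: P_def)
    have "\<not> P k'" using not_less_Least[of k' P] k' k_def by simp
    then have "on_cycle z (c k') (c k)" using k' by (auto simp: P_def)
    then show ?thesis by (auto simp: on_cycle_def)
  qed (use meet in simp)
  define Q where "Q l \<longleftrightarrow> l > k \<and> c l \<in> range z" for l
  define l where "l = (LEAST l. Q l)"
  \<comment> \<open>After one full round \<open>c\<close> is back at \<open>c k\<close>, so a next
    vertex on \<open>z\<close> exists.\<close>
  have "Q (k + n)" using ck per n by (auto simp: Q_def)
  then have Ql: "Q l" unfolding l_def by (rule LeastI)
  have between: "c i \<notin> range z" if "k < i" "i < l" for i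
    using not_less_Least[of i Q] that l_def by (auto simp: Q_def)
  have offi: "\<not> on_cycle z (c i) (c (Suc i))" if "k \<le> i" "i < l" for i
  proof (cases "i = k")
    case False
    then show ?thesis using between[of i] that by (auto simp: on_cycle_def)
  qed (use Pk P_def in auto)
  have Ei: "(c i, c (Suc i)) \<in> E" if "k \<le> i" "i < l" for i using offi[OF that] cE by blast
  have kl: "k < l" using Ql by (simp add: Q_def)
  have "((c (k + 0), c (k + 1)), (c (k + (l - k - 1)), c (k + (l - k)))) \<in> (nb_step E)\<^sup>*"
    using nb_walk[where n = "l - k" and p = "\<lambda>i. c (k + i)" and E = E] Ei kl
      periodic_cycle_neq_add2[OF c] by (simp add: numeral_2_eq_2) metis
  then have reach: "((c k, c (Suc k)), (c (l - 1), c l)) \<in> (nb_step E)\<^sup>*" using kl by simp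
  show ?thesis
  proof (rule nb_merging_excursion[OF z E ck _ _ _ _ _ reach])
    show "c l \<in> range z" using Ql by (simp add: Q_def)
    show "\<not> on_cycle z (c k) (c (Suc k))" "(c k, c (Suc k)) \<in> E" using offi Ei kl by auto
    show "\<not> on_cycle z (c (l - 1)) (c l)" "(c (l - 1), c l) \<in> E"
      using offi[of "l - 1"] Ei[of "l - 1"] kl by auto
  qed
qed

section \<open>Connecting cycles by shortest paths\<close>

text \<open>The length is minimized over all starting points in \<open>S\<close> and end points in
  \<open>T\<close>. A repeated vertex, a later visit to \<open>S\<close> or an earlier one to
  \<open>T\<close> would give a shorter path.\<close>

lemma shortest_path:
  assumes "a \<in> S" "b \<in> T" "(a, b) \<in> E\<^sup>*" "S \<inter> T = {}"
  obtains p :: "nat \<Rightarrow> 'n" and n where "n > 0" "p 0 \<in> S" "p n \<in> T"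
    "\<And>i. i < n \<Longrightarrow> (p i, p (Suc i)) \<in> E" "inj_on p {..n}"
    "\<And>i. 0 < i \<Longrightarrow> i \<le> n \<Longrightarrow> p i \<notin> S" "\<And>i. i < n \<Longrightarrow> p i \<notin> T"
proof -
  define P where "P n \<longleftrightarrow> (\<exists>x\<in>S. \<exists>y\<in>T. (x, y) \<in> E ^^ n)" for n
  define n where "n = (LEAST n. P n)"
  obtain n0 where "(a, b) \<in> E ^^ n0" using assms(3) rtrancl_power by blast
  then have "P n0" using assms by (auto simp: P_def)
  then have "P n" unfolding n_def by (rule LeastI)
  then obtain x y where xy: "x \<in> S" "y \<in> T" "(x, y) \<in> E ^^ n" by (auto simp: P_def)
  have least: "n \<le> k" if "P k" for k unfolding n_def using that by (rule Least_le)
  obtain p where p: "p 0 = x" "p n = y" "\<And>i. i < n \<Longrightarrow> (p i, p (Suc i)) \<in> E"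
    using xy(3) unfolding relpow_fun_conv by blast
  have sub: "(p i, p (i + d)) \<in> E ^^ d" if "i + d \<le> n" for i d
    unfolding relpow_fun_conv using that p(3) by (intro exI[of _ "\<lambda>k. p (i + k)"]) auto
  have pre: "(x, p i) \<in> E ^^ i" if "i \<le> n" for i using sub[of 0 i] that p by simp
  have suf: "(p i, y) \<in> E ^^ (n - i)" if "i \<le> n" for i using sub[of i "n - i"] that p by simp
  have shortcut: False if "i < j" "j \<le> n" "p i = p j" for i j
  proof -
    have "(x, y) \<in> E ^^ (i + (n - j))"
      unfolding relpow_add using pre[of i] suf[of j] that by auto
    then have "P (i + (n - j))" using xy by (auto simp: P_def)
    from least[OF this] show False using that by simp
  qed
  show ?thesis
  proof
    show "n > 0" using xy assms(4) by (cases n) auto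
    show "inj_on p {..n}" by (rule linorder_inj_onI) (use shortcut in auto)
    show "p i \<notin> S" if "0 < i" "i \<le> n" for i
    proof
      assume "p i \<in> S"
      then have "P (n - i)" using suf[of i] that xy by (auto simp: P_def)
      from least[OF this] show False using that by simp
    qed
    show "p i \<notin> T" if "i < n" for i
    proof
      assume "p i \<in> T"
      then have "P i" using pre[of i] that xy by (auto simp: P_def)
      from least[OF this] show False using that by simp
    qed
  qed (use p xy in auto)
qed

text \<open>The excursion follows a shortest path to \<open>w\<close>, goes around \<open>w\<close>,
  and follows a shortest path back. The stretch on \<open>w\<close> lets it turn around without
  backtracking even if the two paths are reverses of each other.\<close>

lemma nb_merging_disjoint_cycles:
  assumes z: "periodic_cycle m z" and E: "\<And>k. (z k, z (Suc k)) \<in> E"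
    and w: "periodic_cycle n w" and Ew: "\<And>k. (w k, w (Suc k)) \<in> E"
    and disj: "range z \<inter> range w = {}"
    and conn: "(z 0, w 0) \<in> E\<^sup>*" "(w 0, z 0) \<in> E\<^sup>*"
  shows "nb_merging E"
proof -
  obtain p l where p: "l > 0" "p 0 \<in> range z" "p l \<in> range w"
    "\<And>i. i < l \<Longrightarrow> (p i, p (Suc i)) \<in> E" "inj_on p {..l}"
    "\<And>i. 0 < i \<Longrightarrow> i \<le> l \<Longrightarrow> p i \<notin> range z" "\<And>i. i < l \<Longrightarrow> p i \<notin> range w"
    by (rule shortest_path[OF _ _ conn(1) disj]) auto
  have disj': "range w \<inter> range z = {}" using disj by blast
  obtain s k where s: "k > 0" "s 0 \<in> range w" "s k \<in> range z"
    "\<And>i. i < k \<Longrightarrow> (s i, s (Suc i)) \<in> E" "inj_on s {..k}"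
    "\<And>i. 0 < i \<Longrightarrow> i \<le> k \<Longrightarrow> s i \<notin> range w" "\<And>i. i < k \<Longrightarrow> s i \<notin> range z"
    by (rule shortest_path[OF _ _ conn(2) disj']) auto
  obtain a where a: "p l = w a" using p(3) by blast
  obtain b where b: "s 0 = w (Suc b)" using periodic_cycle_pred[OF w s(2)] by blast
  have 1: "((p 0, p 1), (p (l - 1), p l)) \<in> (nb_step E)\<^sup>*"
    by (rule nb_walk) (use p in \<open>auto dest: inj_onD\<close>)
  have 2: "((p (l - 1), p l), (w a, w (Suc a))) \<in> nb_step E"
  proof -
    have "p (l - 1) \<noteq> w (Suc a)" using p(7)[of "l - 1"] p(1) by auto
    then show ?thesis using p(4)[of "l - 1"] p(1) Ew[of a] a by (auto simp: nb_step_def)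
  qed
  have 3: "((w a, w (Suc a)), (w b, w (Suc b))) \<in> (nb_step E)\<^sup>*"
    by (rule nb_cycle_reach[OF w Ew refl refl refl refl])
  have 4: "((w b, w (Suc b)), (s 0, s 1)) \<in> nb_step E"
  proof -
    have "s 1 \<noteq> w b" using s(6)[of 1] s(1) by auto
    then show ?thesis using s(4)[of 0] s(1) Ew[of b] b by (auto simp: nb_step_def)
  qed
  have 5: "((s 0, s 1), (s (k - 1), s k)) \<in> (nb_step E)\<^sup>*"
    by (rule nb_walk) (use s in \<open>auto dest: inj_onD\<close>)
  have reach: "((p 0, p 1), (s (k - 1), s k)) \<in> (nb_step E)\<^sup>*"
    using 1 2 3 4 5 by (meson rtrancl.rtrancl_into_rtrancl rtrancl_trans)
  have "p 1 \<notin> range z" "s (k - 1) \<notin> range z" using p(6)[of 1] s(7)[of "k - 1"] p(1) s(1) by auto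
  then have "\<not> on_cycle z (p 0) (p 1)" "\<not> on_cycle z (s (k - 1)) (s k)"
    by (auto simp: on_cycle_def)
  then show ?thesis
    by (rule nb_merging_excursion[OF z E p(2) s(3) _ _ _ _ reach])
       (use p(1) p(4)[of 0] s(1) s(4)[of "k - 1"] in auto)
qed

text \<open>The edge closes a shortest path from \<open>y\<close> back to \<open>x\<close>. As the
  reverse edge is missing, that path has at least two edges and the cycle has length at least
  3.\<close>

lemma one_way_edge_on_cycle:
  assumes "(x, y) \<in> E" "(y, x) \<notin> E" "(y, x) \<in> E\<^sup>*" "x \<noteq> y"
  obtains m z where "periodic_cycle m z" "\<And>k. (z k, z (Suc k)) \<in> E" "on_cycle z x y" "z 0 = y"
proof -
  have "{y} \<inter> {x} = {}" using assms by auto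
  from shortest_path[OF _ _ assms(3) this] obtain p n where p: "n > 0" "p 0 \<in> {y}" "p n \<in> {x}"
    "\<And>i. i < n \<Longrightarrow> (p i, p (Suc i)) \<in> E" "inj_on p {..n}"
    "\<And>i. 0 < i \<Longrightarrow> i \<le> n \<Longrightarrow> p i \<notin> {y}" "\<And>i. i < n \<Longrightarrow> p i \<notin> {x}"
    by blast
  have n2: "n \<ge> 2"
  proof (rule ccontr)
    assume "\<not> n \<ge> 2"
    then have "n = 1" using p(1) by simp
    then show False using p(2-4) assms(2) by force
  qed
  \<comment> \<open>The path has \<open>Suc n\<close> vertices; the edge \<open>(x, y)\<close> is
    the wrap-around from index \<open>n\<close> to 0.\<close>
  define z where "z k = p (k mod Suc n)" for k
  show ?thesis
  proof
    show "periodic_cycle (Suc n) z"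
      unfolding periodic_cycle_def
    proof (intro conjI allI)
      show "inj_on z {..<Suc n}" using p(5) by (auto simp: inj_on_def z_def)
      show "z (k + Suc n) = z k" for k unfolding z_def by (simp only: mod_add_self2)
    qed (use n2 in simp)
    show "(z k, z (Suc k)) \<in> E" for k
    proof (cases "k mod Suc n = n")
      case True
      then have "Suc k mod Suc n = 0" by (simp add: mod_Suc)
      then show ?thesis using True p(2,3) assms(1) by (simp add: z_def)
    next
      case False
      then have "Suc k mod Suc n = Suc (k mod Suc n)" by (simp add: mod_Suc)
      moreover have "k mod Suc n < n" using False by (meson le_neq_implies_less mod_less_divisor less_Suc_eq_le zero_less_Suc)
      ultimately show ?thesis using p(4) by (simp add: z_def)
    qed
    show "on_cycle z x y" unfolding on_cycle_def z_def using p(2,3)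
      by (intro exI[of _ n]) auto
    show "z 0 = y" using p(2) by (simp add: z_def)
  qed
qed

section \<open>Cycles up to rotation and reversal\<close>

text \<open>Reversal turns a rotation into one by the complementary amount. This lets the two forms
  in \<open>cycle_equiv\<close> be composed and inverted.\<close>

lemma rev_rotate_ex: "\<exists>k. rev (rotate m xs) = rotate k (rev xs)"
proof (cases "xs = []")
  case False
  let ?n = "length xs"
  have "rotate (?n - m mod ?n) (rev xs) = rev (rotate (?n - (?n - m mod ?n) mod ?n) xs)"
    by (rule rotate_rev)
  also have "rotate (?n - (?n - m mod ?n) mod ?n) xs = rotate m xs"
  proof (cases "m mod ?n = 0")
    case True
    then show ?thesis by simp
  next
    case nz: False
    then have "(?n - m mod ?n) mod ?n = ?n - m mod ?n" using False by (intro mod_less) auto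
    moreover have "m mod ?n \<le> ?n" using False by (simp add: less_imp_le)
    ultimately show ?thesis using rotate_conv_mod[of m xs] by simp
  qed
  finally show ?thesis by metis
qed simp

lemma rotate_inverse_ex: "\<exists>k. rotate k (rotate m xs) = xs"
proof (cases "xs = []")
  case False
  let ?n = "length xs"
  have "(?n - m mod ?n + m) mod ?n = (?n - m mod ?n + m mod ?n) mod ?n" by (metis mod_add_right_eq)
  also have "\<dots> = 0" using False by (simp add: less_imp_le)
  finally have "rotate (?n - m mod ?n) (rotate m xs) = xs" by (simp add: rotate_rotate)
  then show ?thesis by blast
qed simp

lemma cycle_equiv_sym: "cycle_equiv xs ys \<Longrightarrow> cycle_equiv ys xs"
  unfolding cycle_equiv_def by (metis rev_rotate_ex rotate_inverse_ex rev_rev_ident)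

lemma cycle_equiv_trans: "cycle_equiv xs ys \<Longrightarrow> cycle_equiv ys zs \<Longrightarrow> cycle_equiv xs zs"
  unfolding cycle_equiv_def by (metis rev_rotate_ex rotate_rotate rev_rev_ident)

lemma periodic_cycle_dvd:
  assumes "periodic_cycle m z" "z (a + d) = z a" shows "m dvd d"
  using assms(2) unfolding periodic_cycle_eq_iff[OF assms(1)] by (metis add_diff_cancel_left' le_add1 mod_eq_dvd_iff_nat)

lemma periodic_cycle_of_list:
  assumes "length xs \<ge> 3" "distinct xs"
  shows "periodic_cycle (length xs) (\<lambda>k. xs ! (k mod length xs))"
  using assms unfolding periodic_cycle_def by (auto simp: inj_on_def nth_eq_iff_index_eq)

lemma is_cycle_step:
  assumes "is_cycle U xs"
  shows "U (xs ! (k mod length xs)) (xs ! (Suc k mod length xs))"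
proof -
  let ?n = "length xs"
  have n: "?n \<ge> 3" "xs \<noteq> []" using assms by (auto simp: is_cycle_def)
  show ?thesis
  proof (cases "Suc (k mod ?n) = ?n")
    case True
    then have "Suc k mod ?n = 0" "k mod ?n = ?n - 1" by (auto simp: mod_Suc)
    then show ?thesis using assms n by (simp add: is_cycle_def last_conv_nth hd_conv_nth)
  next
    case False
    moreover have "k mod ?n < ?n" using n by simp
    ultimately have "Suc k mod ?n = Suc (k mod ?n)" "Suc (k mod ?n) < ?n" by (auto simp: mod_Suc)
    then show ?thesis using assms by (simp add: is_cycle_def)
  qed
qed

text \<open>The two residues add up to at most \<open>2 * m - 2\<close>, so a sum congruent to
  \<open>m - 1\<close> must equal it. The right-hand side is how reversing a list of length
  \<open>m\<close> renumbers its entries.\<close>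

lemma mod_complement_nat:
  assumes "(a + b) mod m = m - 1" "0 < (m::nat)" shows "a mod m = m - 1 - b mod m"
proof -
  have lt: "a mod m < m" "b mod m < m" using assms by auto
  have *: "(a mod m + b mod m) mod m = m - 1" using assms by (simp add: mod_add_eq)
  show ?thesis
  proof (cases "a mod m + b mod m < m")
    case True
    then show ?thesis using * by simp
  next
    case False
    then have "a mod m + b mod m - m = m - 1" using * lt
      by (metis add.commute le_add_diff_inverse2 less_diff_conv2 mod_add_self2 mod_less not_less add_less_mono)
    then show ?thesis using lt by linarith
  qed
qed

text \<open>A cycle whose edges all lie on another cycle is a rotation of it, in one of the two directions.
  The reverse direction is encoded by steps of \<open>m - 1\<close> modulo \<open>m\<close>.\<close>

lemma cycle_within_cycle:
  assumes z: "periodic_cycle m z" and c: "periodic_cycle n c"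
    and on: "\<And>k. on_cycle z (c k) (c (Suc k))"
  obtains i where "m = n" "\<And>k. c k = z (i + k)" | i where "m = n" "\<And>k. c k = z (Suc i + (m - 1) * k)"
proof -
  have m: "m \<ge> 3" and per: "\<And>k. z (k + m) = z k" using z by (auto simp: periodic_cycle_def)
  have cper: "c n = c 0" using c unfolding periodic_cycle_def by (metis add_0)
  from on[of 0] consider i where "c 0 = z i" "c 1 = z (Suc i)" | i where "c 0 = z (Suc i)" "c 1 = z i"
    unfolding on_cycle_def by (auto simp: One_nat_def)
  then show ?thesis
  proof cases
    case 1
    \<comment> \<open>Two consecutive entries are carried through the induction, so that the
      direction of the last step is known.\<close>
    have "c k = z (i + k) \<and> c (Suc k) = z (i + Suc k)" for k
    proof (induction k)
      case (Suc k)
      obtain l where l: "(c (Suc k) = z l \<and> c (Suc (Suc k)) = z (Suc l)) \<or>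
          (c (Suc k) = z (Suc l) \<and> c (Suc (Suc k)) = z l)"
        using on[of "Suc k"] unfolding on_cycle_def by blast
      from l show ?case
      proof
        assume A: "c (Suc k) = z l \<and> c (Suc (Suc k)) = z (Suc l)"
        then have "z l = z (i + Suc k)" using Suc by simp
        from periodic_cycle_shift[OF z this, of 1] show ?case using A Suc by simp
      next
        assume A: "c (Suc k) = z (Suc l) \<and> c (Suc (Suc k)) = z l"
        then have "z (Suc l) = z (Suc (i + k))" using Suc by simp
        \<comment> \<open>Turning around on \<open>z\<close> would make \<open>c\<close> return to
          \<open>c k\<close> after two steps, which a cycle of length at least 3 excludes.\<close>
        then have "z l = z (i + k)" by (rule periodic_cycle_Suc_cancel[OF z])
        then show ?case using A Suc periodic_cycle_neq_add2[OF c, of k] by (simp add: numeral_2_eq_2)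
      qed
    qed (use 1 in auto)
    then have ck: "\<And>k. c k = z (i + k)" by simp
    have "m dvd n" using periodic_cycle_dvd[OF z, of i n] ck[of n] ck[of 0] cper by simp
    moreover have "n dvd m" using periodic_cycle_dvd[OF c, of 0 m] ck[of m] ck[of 0] per by simp
    ultimately show ?thesis using that(1) ck by (simp add: dvd_antisym)
  next
    case 2
    define M where "M = m - 1"
    have M: "m = Suc M" using m by (simp add: M_def)
    have "c k = z (Suc i + M * k) \<and> c (Suc k) = z (Suc i + M * Suc k)" for k
    proof (induction k)
      case 0
      show ?case using 2 per[of i] by (simp add: M)
    next
      case (Suc k)
      define j where "j = Suc i + M * k"
      have j: "c k = z j" "c (Suc k) = z (j + M)"
        using Suc by (simp_all add: j_def algebra_simps)
      obtain l where l: "(c (Suc k) = z l \<and> c (Suc (Suc k)) = z (Suc l)) \<or>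
          (c (Suc k) = z (Suc l) \<and> c (Suc (Suc k)) = z l)"
        using on[of "Suc k"] unfolding on_cycle_def by blast
      from l show ?case
      proof
        assume A: "c (Suc k) = z l \<and> c (Suc (Suc k)) = z (Suc l)"
        then have "z l = z (j + M)" using j by simp
        from periodic_cycle_shift[OF z this, of 1] have "z (Suc l) = z (j + m)" using M by simp
        then show ?case using A j per periodic_cycle_neq_add2[OF c, of k] by (simp add: numeral_2_eq_2)
      next
        assume A: "c (Suc k) = z (Suc l) \<and> c (Suc (Suc k)) = z l"
        then have "z (Suc l) = z (j + M)" using j by simp
        from periodic_cycle_shift[OF z this, of M] have "z (l + m) = z (j + M + M)"
          using M by simp
        then show ?case using A j(2) Suc per[of l] by (simp add: j_def algebra_simps)
      qed
    qed
    then have ck: "\<And>k. c k = z (Suc i + (m - 1) * k)" by (simp add: M_def)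
    \<comment> \<open>A round of \<open>c\<close> shifts \<open>z\<close> by
      \<open>(m - 1) * n\<close>. Another \<open>n\<close> steps complete this to a multiple of
      \<open>m\<close>, so \<open>n\<close> is itself a period of \<open>z\<close>.\<close>
    have "z (Suc i + (m - 1) * n) = z (Suc i)" using ck[of n] ck[of 0] cper by simp
    from periodic_cycle_shift[OF z this, of n] have "z (Suc i + n) = z (Suc i + (m - 1) * n + n)" by simp
    also have "Suc i + (m - 1) * n + n = Suc i + m * n" using m by (cases m) auto
    also have "z \<dots> = z (Suc i)" unfolding periodic_cycle_eq_iff[OF z] by simp
    finally have "m dvd n" by (rule periodic_cycle_dvd[OF z])
    moreover have "n dvd m"
    proof (rule periodic_cycle_dvd[OF c])
      have "z (Suc i + (m - 1) * m) = z (Suc i)" unfolding periodic_cycle_eq_iff[OF z] by simp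
      then show "c (0 + m) = c 0" using ck[of m] ck[of 0] by simp
    qed
    ultimately show ?thesis using that(2) ck by (simp add: dvd_antisym)
  qed
qed

lemma cycle_within_cycle_equiv:
  assumes z: "periodic_cycle m z" and xs: "length xs \<ge> 3" "distinct xs"
    and on: "\<And>k. on_cycle z (xs ! (k mod length xs)) (xs ! (Suc k mod length xs))"
  shows "cycle_equiv (map z [0..<m]) xs"
proof -
  let ?zs = "map z [0..<m]"
  have m: "m > 0" using z by (simp add: periodic_cycle_def)
  from cycle_within_cycle[OF z periodic_cycle_of_list[OF xs] on] show ?thesis
  proof cases
    case (1 i)
    have "xs = rotate i ?zs"
    proof (rule nth_equalityI)
      fix k assume k: "k < length xs"
      then have "xs ! k = z (i + k)" using 1(2)[of k] by simp
      then show "xs ! k = rotate i ?zs ! k"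
        using k 1(1) m periodic_cycle_mod[OF z] by (simp add: nth_rotate add.commute)
    qed (use 1 in simp)
    then show ?thesis unfolding cycle_equiv_def by blast
  next
    case (2 i)
    \<comment> \<open>Modulo \<open>m\<close> this is \<open>-(i + 2)\<close>, written without
      subtraction. It makes the index of \<open>xs ! k\<close> in \<open>z\<close> and the index
      \<open>s + k\<close> in the rotated list add up to -1.\<close>
    define s where "s = (m - 1) * (i + 2)"
    have "xs = rotate s (rev ?zs)"
    proof (rule nth_equalityI)
      fix k assume k: "k < length xs"
      have "Suc i + (m - 1) * k + (s + k) = m - 1 + m * (k + i + 1)"
        using m by (cases m) (auto simp: s_def algebra_simps)
      moreover have "(m - 1 + m * (k + i + 1)) mod m = (m - 1) mod m" by (rule mod_mult_self2)
      ultimately have "(Suc i + (m - 1) * k + (s + k)) mod m = m - 1" using m by simp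
      from mod_complement_nat[OF this m]
      have "(Suc i + (m - 1) * k) mod m = m - 1 - (s + k) mod m" .
      moreover have "xs ! k = z (Suc i + (m - 1) * k)" using 2(2)[of k] k by simp
      ultimately have "xs ! k = z (m - 1 - (s + k) mod m)" using periodic_cycle_mod[OF z] by metis
      then show "xs ! k = rotate s (rev ?zs) ! k"
        using k 2(1) m by (simp add: nth_rotate rev_nth add.commute)
    qed (use 2 in simp)
    then show ?thesis unfolding cycle_equiv_def by blast
  qed
qed

section \<open>Merging edges in a component with two cycles\<close>

lemma nb_merging_two_directed_cycles:
  assumes z: "periodic_cycle m z" and Ez: "\<And>k. (z k, z (Suc k)) \<in> E"
    and w: "periodic_cycle n w" and Ew: "\<And>k. (w k, w (Suc k)) \<in> E"
    and conn: "(z 0, w 0) \<in> E\<^sup>*" "(w 0, z 0) \<in> E\<^sup>*"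
    and off: "\<not> on_cycle z (w b) (w (Suc b))"
  shows "nb_merging E"
proof (cases "range z \<inter> range w = {}")
  case True
  show ?thesis by (rule nb_merging_disjoint_cycles[OF z Ez w Ew True conn])
next
  case False
  then obtain k a where "z k = w a" by auto
  then have "w a \<in> range z" by (metis rangeI)
  then show ?thesis using nb_merging_meeting_cycle[OF z Ez w _ _ off] Ew by blast
qed

text \<open>If \<open>c\<close> runs against a one-way edge off \<open>z\<close>, that edge lies on
  a second directed cycle. Otherwise \<open>c\<close> can be walked wherever it leaves
  \<open>z\<close>: it either meets \<open>z\<close>, or is a directed cycle disjoint from
  it.\<close>

lemma nb_merging_directed_and_undirected_cycle:
  assumes noloops: "\<forall>i. (i, i) \<notin> E" and conn: "\<And>x y. x \<in> C \<Longrightarrow> y \<in> C \<Longrightarrow> (x, y) \<in> E\<^sup>*"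
    and z: "periodic_cycle m z" and Ez: "\<And>k. (z k, z (Suc k)) \<in> E" and z0: "z 0 \<in> C"
    and c: "periodic_cycle n c" and adj: "\<And>k. und_adj E C (c k) (c (Suc k))"
    and off: "\<not> on_cycle z (c b) (c (Suc b))"
  shows "nb_merging E"
proof -
  have one_way: "nb_merging E"
    if xy: "x \<in> C" "y \<in> C" "(x, y) \<in> E" "(y, x) \<notin> E" "\<not> on_cycle z x y" for x y
  proof -
    have "x \<noteq> y" using xy noloops by blast
    from one_way_edge_on_cycle[OF xy(3,4) conn[OF xy(2,1)] this] obtain l w where
      w: "periodic_cycle l w" "\<And>k. (w k, w (Suc k)) \<in> E" "on_cycle w x y" "w 0 = y" by metis
    obtain a where "\<not> on_cycle z (w a) (w (Suc a))"
      using w(3) xy(5) unfolding on_cycle_def[of w] by (blast intro: on_cycle_sym)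
    from nb_merging_two_directed_cycles[OF z Ez w(1,2) _ _ this] show ?thesis
      using conn w(4) z0 xy by simp
  qed
  have inC: "c k \<in> C" for k using adj[of k] by (simp add: und_adj_def)
  show ?thesis
  proof (cases "\<exists>k. \<not> on_cycle z (c k) (c (Suc k)) \<and> (c k, c (Suc k)) \<notin> E")
    case True
    then obtain k where k: "\<not> on_cycle z (c k) (c (Suc k))" "(c k, c (Suc k)) \<notin> E" by blast
    then have "(c (Suc k), c k) \<in> E" using adj[of k] by (auto simp: und_adj_def)
    then show ?thesis using one_way[OF inC inC _ k(2)] k(1) on_cycle_sym by metis
  next
    case False
    then have dir: "\<And>k. on_cycle z (c k) (c (Suc k)) \<or> (c k, c (Suc k)) \<in> E" by blast
    show ?thesis
    proof (cases "\<exists>a. c a \<in> range z")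
      case True
      then show ?thesis using nb_merging_meeting_cycle[OF z Ez c dir _ off] by blast
    next
      case disj: False
      then have "\<not> on_cycle z (c k) (c (Suc k))" for k by (auto simp: on_cycle_def)
      then have "\<And>k. (c k, c (Suc k)) \<in> E" using dir by blast
      from nb_merging_two_directed_cycles[OF z Ez c this _ _ off] show ?thesis
        using conn z0 inC by blast
    qed
  qed
qed

lemma component_connected:
  assumes "C \<in> components E" "x \<in> C" "y \<in> C" shows "(x, y) \<in> E\<^sup>*"
  using assms unfolding components_def comp_rel_def quotient_def by auto

text \<open>A directed cycle \<open>z\<close> exists in the component: either \<open>xs\<close> is
  one, or it runs against a one-way edge, which lies on one.\<close>

lemma nb_merging_if_more_than_one_cycle:
  assumes noloops: "\<forall>i. (i, i) \<notin> E" and C: "C \<in> components E"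
    and more: "more_than_one_cycle (und_adj E C)"
  shows "nb_merging E"
proof -
  have conn: "\<And>x y. x \<in> C \<Longrightarrow> y \<in> C \<Longrightarrow> (x, y) \<in> E\<^sup>*" by (rule component_connected[OF C])
  obtain xs ys where cyc: "is_cycle (und_adj E C) xs" "is_cycle (und_adj E C) ys"
    and neq: "\<not> cycle_equiv xs ys" using more unfolding more_than_one_cycle_def by blast
  define c where "c us = (\<lambda>k. us ! (k mod length us))" for us :: "'a list"
  have per: "periodic_cycle (length us) (c us)" if "is_cycle (und_adj E C) us" for us
    unfolding c_def using that by (intro periodic_cycle_of_list) (auto simp: is_cycle_def)
  have adj: "und_adj E C (c us k) (c us (Suc k))" if "is_cycle (und_adj E C) us" for us k
    unfolding c_def by (rule is_cycle_step[OF that])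
  obtain m z where z: "periodic_cycle m z" "\<And>k. (z k, z (Suc k)) \<in> E" "z 0 \<in> C"
  proof (cases "\<exists>k. (c xs k, c xs (Suc k)) \<notin> E")
    case True
    then obtain k where k: "(c xs k, c xs (Suc k)) \<notin> E" by blast
    let ?x = "c xs (Suc k)" and ?y = "c xs k"
    have a: "?x \<in> C" "?y \<in> C" "?x \<noteq> ?y" "(?x, ?y) \<in> E" using adj[OF cyc(1), of k] k by (auto simp: und_adj_def)
    from one_way_edge_on_cycle[OF a(4) k conn[OF a(2,1)] a(3)] a(2) that show ?thesis by metis
  next
    case False
    then show ?thesis using that[OF per[OF cyc(1)]] adj[OF cyc(1), of 0] by (auto simp: und_adj_def)
  qed
  \<comment> \<open>If all edges of all undirected cycles lay on \<open>z\<close>, then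
    \<open>xs\<close> and \<open>ys\<close> would both be equivalent to \<open>z\<close>, hence to
    each other.\<close>
  have "\<exists>us. is_cycle (und_adj E C) us \<and> (\<exists>k. \<not> on_cycle z (c us k) (c us (Suc k)))"
  proof (rule ccontr)
    assume neg: "\<not> ?thesis"
    have "cycle_equiv (map z [0..<m]) us" if "is_cycle (und_adj E C) us" for us
      by (rule cycle_within_cycle_equiv[OF z(1)]) (use that neg in \<open>auto simp: is_cycle_def c_def\<close>)
    then show False using cyc neq cycle_equiv_sym cycle_equiv_trans by metis
  qed
  then obtain us k where us: "is_cycle (und_adj E C) us" "\<not> on_cycle z (c us k) (c us (Suc k))" by blast
  show ?thesis
    by (rule nb_merging_directed_and_undirected_cycle[OF noloops conn z per[OF us(1)] adj[OF us(1)] us(2)])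
qed

subsection \<open>Weights of walks by their last edge\<close>

text \<open>The condition \<open>0 < k\<close> excludes the walk without edges, for which the
  truncated \<open>k - 1\<close> would name its only vertex as the penultimate one.\<close>

definition end_weight :: "('n::finite \<times> 'n) set \<Rightarrow> real \<Rightarrow> nat \<Rightarrow> 'n \<Rightarrow> 'n \<Rightarrow> 'n \<Rightarrow> real" where
  "end_weight E \<omega> k i x y = (\<Sum>w\<in>{w \<in> walks E k i y. 0 < k \<and> w ! (k - 1) = x}. \<omega> ^ nbacktrack w)"

lemma finite_walks: "finite (walks E k i (j :: 'n::finite))"
  by (rule finite_subset[OF _ finite_lists_length_eq[of UNIV "Suc k"]]) (auto simp: walks_def)

lemma walks_snoc:
  "{w \<in> walks E (Suc k) i z. w ! k = y} = (if (y, z) \<in> E then (\<lambda>v. v @ [z]) ` walks E k i y else {})"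
proof -
  have "w \<in> (\<lambda>v. v @ [z]) ` walks E k i y \<and> (y, z) \<in> E" if "w \<in> walks E (Suc k) i z" "w ! k = y" for w
  proof -
    from that have w: "length w = Suc (Suc k)" "w ! 0 = i" "w ! Suc k = z"
      "\<And>r. r < Suc k \<Longrightarrow> (w ! r, w ! Suc r) \<in> E" by (auto simp: walks_def)
    have "butlast w ! r = w ! r" if "r \<le> k" for r using w(1) that by (simp add: nth_butlast)
    then have "butlast w \<in> walks E k i y"
      unfolding walks_def using w that(2) by auto
    moreover have "w = butlast w @ [z]"
      using w by (metis append_butlast_last_id diff_Suc_1 last_conv_nth length_0_conv nat.distinct(1))
    moreover have "(y, z) \<in> E" using w(4)[of k] w(3) that(2) by simp
    ultimately show ?thesis by blast
  qed
  moreover have "v @ [z] \<in> walks E (Suc k) i z \<and> (v @ [z]) ! k = y"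
    if "v \<in> walks E k i y" "(y, z) \<in> E" for v
    using that by (auto simp: walks_def nth_append less_Suc_eq)
  ultimately show ?thesis by auto
qed

text \<open>Appending a vertex can only add the position \<open>k - 1\<close>, and only if the walk
  already has an edge.\<close>

lemma nbacktrack_snoc:
  assumes "length v = Suc k"
  shows "nbacktrack (v @ [z]) = nbacktrack v + (if 0 < k \<and> v ! (k - 1) = z then 1 else 0)"
proof -
  define B where "B w = {r. Suc (Suc r) < length w \<and> w ! Suc (Suc r) = w ! r}" for w :: "'a list"
  have fin: "finite (B v)" by (rule finite_subset[of _ "{..<length v}"]) (auto simp: B_def)
  have B: "B (v @ [z]) = (if 0 < k \<and> v ! (k - 1) = z then insert (k - 1) (B v) else B v)"
    (is "_ = ?R")
  proof (rule set_eqI)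
    fix r
    consider "r < k - 1" | "0 < k" "r = k - 1" | "k \<le> r" by linarith
    then show "r \<in> B (v @ [z]) \<longleftrightarrow> r \<in> ?R"
      using assms by cases (auto simp: nth_append B_def)
  qed
  have "k - 1 \<notin> B v" if "0 < k" using assms that by (auto simp: B_def)
  then have "card (B (v @ [z])) = card (B v) + (if 0 < k \<and> v ! (k - 1) = z then 1 else 0)"
    using fin by (simp add: B)
  then show ?thesis by (simp only: nbacktrack_def B_def)
qed

lemma sums_at_0: "(\<lambda>k. (if k = 0 then a else 0) * t ^ k) sums (a :: real)"
proof -
  have "(\<lambda>k. (if k = 0 then a else 0) * t ^ k) = (\<lambda>k. if k = 0 then a else 0)" by auto
  then show ?thesis using sums_single[of 0 "\<lambda>_. a"] by simp
qed

lemma end_weight_0 [simp]: "end_weight E \<omega> 0 i x y = 0"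
  by (simp add: end_weight_def)

lemma end_weight_nonneg: "0 \<le> \<omega> \<Longrightarrow> 0 \<le> end_weight E \<omega> k i x y"
  unfolding end_weight_def by (intro sum_nonneg) auto

text \<open>Walks ending at \<open>y\<close> are extended by \<open>z\<close>. Those whose last edge
  is \<open>(z, y)\<close> gain a factor \<omega>, so a share of 1 - \<omega> of their weight is
  subtracted.\<close>

lemma end_weight_Suc:
  "end_weight E \<omega> (Suc k) i y z =
    (if (y, z) \<in> E then qmat E \<omega> k $ i $ y - (1 - \<omega>) * end_weight E \<omega> k i z y else 0)"
proof (cases "(y, z) \<in> E")
  case True
  let ?W = "walks E k i y" and ?P = "\<lambda>v. 0 < k \<and> v ! (k - 1) = z"
  have "end_weight E \<omega> (Suc k) i y z = (\<Sum>v\<in>?W. \<omega> ^ nbacktrack (v @ [z]))"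
    unfolding end_weight_def using True by (simp add: walks_snoc sum.reindex inj_on_def)
  also have "\<dots> = (\<Sum>v\<in>?W. \<omega> ^ nbacktrack v - (1 - \<omega>) * (if ?P v then \<omega> ^ nbacktrack v else 0))"
    by (intro sum.cong refl) (auto simp: walks_def nbacktrack_snoc algebra_simps)
  also have "\<dots> = qmat E \<omega> k $ i $ y - (1 - \<omega>) * end_weight E \<omega> k i z y"
    unfolding end_weight_def qmat_def
    by (simp add: sum_subtractf sum_distrib_left[symmetric] sum.inter_filter[symmetric] finite_walks)
  finally show ?thesis using True by simp
qed (simp add: end_weight_def walks_snoc)

lemma qmat_end_weight:
  "qmat E \<omega> k $ i $ y = (if k = 0 \<and> i = y then 1 else 0) + (\<Sum>x\<in>UNIV. end_weight E \<omega> k i x y)"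
proof (cases k)
  case 0
  have "walks E 0 i y = (if i = y then {[i]} else {})"
    by (auto simp: walks_def length_Suc_conv)
  then show ?thesis using 0 by (simp add: qmat_def nbacktrack_def)
next
  case (Suc k')
  have "(\<Sum>x\<in>UNIV. end_weight E \<omega> k i x y) = (\<Sum>w\<in>walks E k i y. \<omega> ^ nbacktrack w)"
    unfolding end_weight_def using Suc sum.group[OF finite_walks finite[of UNIV], of "\<lambda>w. w ! (k - 1)" E k i y] by simp
  then show ?thesis using Suc by (simp add: qmat_def)
qed

lemma qmat_nonneg: "0 \<le> \<omega> \<Longrightarrow> 0 \<le> qmat E \<omega> k $ i $ j"
  unfolding qmat_def by (auto intro: sum_nonneg)

lemma end_weight_le_qmat:
  assumes "0 \<le> \<omega>" shows "end_weight E \<omega> k i x y \<le> qmat E \<omega> k $ i $ y"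
proof -
  have "end_weight E \<omega> k i x y \<le> (\<Sum>x\<in>UNIV. end_weight E \<omega> k i x y)"
    by (rule member_le_sum) (auto intro: end_weight_nonneg assms)
  then show ?thesis by (simp add: qmat_end_weight)
qed

section \<open>The generating matrix of the walk weights\<close>

text \<open>For nonnegative \<omega> and \<open>t\<close> all terms are nonnegative, so entrywise
  convergence is absolute and can be compared with \<open>conv_radius\<close>.\<close>

definition qmat_summable :: "('n::finite \<times> 'n) set \<Rightarrow> real \<Rightarrow> real \<Rightarrow> bool" where
  "qmat_summable E \<omega> t \<longleftrightarrow> (\<forall>i j. summable (\<lambda>k. qmat E \<omega> k $ i $ j * t ^ k))"

definition qmat_gen :: "('n::finite \<times> 'n) set \<Rightarrow> real \<Rightarrow> real \<Rightarrow> real^'n^'n" where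
  "qmat_gen E \<omega> t = (\<chi> i j. \<Sum>k. qmat E \<omega> k $ i $ j * t ^ k)"

lemma summable_end_weight:
  assumes "0 \<le> \<omega>" "0 \<le> t" "qmat_summable E \<omega> t"
  shows "summable (\<lambda>k. end_weight E \<omega> k i x y * t ^ k)"
proof (rule summable_comparison_test')
  show "summable (\<lambda>k. qmat E \<omega> k $ i $ y * t ^ k)" using assms(3) by (simp add: qmat_summable_def)
  show "norm (end_weight E \<omega> k i x y * t ^ k) \<le> qmat E \<omega> k $ i $ y * t ^ k" for k
    using end_weight_le_qmat[OF assms(1), of E k i x y] end_weight_nonneg[OF assms(1), of E k i x y] assms(2)
    by (simp add: abs_mult mult_right_mono)
qed

text \<open>Solving the two coupled linear equations for the edges \<open>(y, z)\<close> and \<open>(z, y)\<close>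
  eliminates the edge-indexed generating functions.\<close>

lemma qmat_gen_times_Mtau:
  assumes \<omega>: "0 \<le> \<omega>" and t: "0 \<le> t" and sm: "qmat_summable E \<omega> t"
  shows "qmat_gen E \<omega> t ** Mtau E (1 - \<omega>) t = (1 - (1 - \<omega>)^2 * t^2) *\<^sub>R mat 1"
proof -
  define \<tau> where "\<tau> = 1 - \<omega>"
  define c where "c = 1 - \<tau>^2 * t^2"
  define A where "A y z = adjm E $ y $ z" for y z
  define Q where "Q i y = qmat_gen E \<omega> t $ i $ y" for i y
  define N where "N i y z = (\<Sum>k. end_weight E \<omega> k i y z * t ^ k)" for i y z
  have smq: "summable (\<lambda>k. qmat E \<omega> k $ i $ y * t ^ k)" for i y using sm by (simp add: qmat_summable_def)
  note sme = summable_end_weight[OF \<omega> t sm]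
  have A01: "A y z = 0 \<or> A y z = 1" for y z by (simp add: A_def adjm_def)
  have Neq: "N i y z = A y z * t * (Q i y - \<tau> * N i z y)" for i y z
  proof -
    have "N i y z = (\<Sum>k. end_weight E \<omega> (Suc k) i y z * t ^ Suc k)"
      unfolding N_def using suminf_split_head[OF sme[of i y z]] by simp
    also have "\<dots> = (\<Sum>k. (A y z * t) * (qmat E \<omega> k $ i $ y * t ^ k - \<tau> * (end_weight E \<omega> k i z y * t ^ k)))"
      by (intro suminf_cong) (simp add: end_weight_Suc A_def adjm_def \<tau>_def right_diff_distrib mult_ac)
    also have "\<dots> = (A y z * t) * (Q i y - \<tau> * N i z y)"
      unfolding Q_def qmat_gen_def N_def
      by (simp add: suminf_mult suminf_diff[symmetric] summable_diff summable_mult smq sme)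
    finally show ?thesis .
  qed
  have Qeq: "Q i z = (if i = z then 1 else 0) + (\<Sum>y\<in>UNIV. N i y z)" for i z
  proof -
    have "(\<lambda>k. (if k = 0 then (if i = z then 1 else 0) else 0) * t ^ k
        + (\<Sum>y\<in>UNIV. end_weight E \<omega> k i y z * t ^ k)) sums
        ((if i = z then 1 else 0) + (\<Sum>y\<in>UNIV. N i y z))"
      unfolding N_def by (intro sums_add sums_at_0 sums_sum summable_sums sme)
    moreover have "(if k = 0 then (if i = z then 1 else 0) else 0) * t ^ k
        + (\<Sum>y\<in>UNIV. end_weight E \<omega> k i y z * t ^ k) = qmat E \<omega> k $ i $ z * t ^ k" for k
      by (auto simp: qmat_end_weight[of E \<omega> k i z] distrib_right sum_distrib_right)
    ultimately show ?thesis unfolding Q_def qmat_gen_def by (simp add: sums_iff)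
  qed
  \<comment> \<open>If both orientations are edges, \<open>c\<close> is the determinant of the two
    equations \<open>Neq\<close>. If the reverse edge is missing, \<open>N i z y\<close>
    vanishes.\<close>
  have key: "c * N i y z = (t * A y z - \<tau>^2 * t^3 * (A y z - A y z * A z y)) * Q i y
      - \<tau> * t^2 * (A y z * A z y) * Q i z" for i y z
  proof (cases "A y z = 1 \<and> A z y = 1")
    case True
    then have "N i y z = t * (Q i y - \<tau> * (t * (Q i z - \<tau> * N i y z)))"
      using Neq[of i y z] Neq[of i z y] by simp
    then show ?thesis using True by (simp add: c_def algebra_simps power2_eq_square)
  next
    case False
    then have "A y z = 0 \<or> A y z = 1 \<and> A z y = 0" using A01 by blast
    then show ?thesis using Neq[of i y z] Neq[of i z y]
      by (auto simp: c_def algebra_simps power2_eq_square power3_eq_cube)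
  qed
  have "(\<Sum>y\<in>UNIV. Q i y * Mtau E \<tau> t $ y $ z) = c * (if i = z then 1 else 0)" for i z
  proof -
    define S where "S = (\<Sum>y\<in>UNIV. A y z * A z y)"
    have M: "Mtau E \<tau> t $ y $ z = (if y = z then c + \<tau> * t^2 * S else 0)
        - (t * A y z - \<tau>^2 * t^3 * (A y z - A y z * A z y))" for y
      by (cases "y = z") (simp_all add: Mtau_def Dmat_def Smat_def mat_def A_def c_def S_def
          matrix_matrix_mult_def algebra_simps power2_eq_square)
    have "(\<Sum>y\<in>UNIV. Q i y * Mtau E \<tau> t $ y $ z)
        = (\<Sum>y\<in>UNIV. (if y = z then Q i z * (c + \<tau> * t^2 * S) else 0)
          - (t * A y z - \<tau>^2 * t^3 * (A y z - A y z * A z y)) * Q i y)"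
      unfolding M by (intro sum.cong refl) (auto simp: algebra_simps)
    also have "\<dots> = Q i z * (c + \<tau> * t^2 * S)
        - (\<Sum>y\<in>UNIV. (t * A y z - \<tau>^2 * t^3 * (A y z - A y z * A z y)) * Q i y)"
      by (simp add: sum_subtractf)
    \<comment> \<open>The contribution of \<open>Dmat\<close> supplies, summand by summand, the
      terms with \<open>Q i z\<close> in \<open>key\<close>.\<close>
    also have "Q i z * (c + \<tau> * t^2 * S) = c * Q i z + (\<Sum>y\<in>UNIV. \<tau> * t^2 * (A y z * A z y) * Q i z)"
      by (simp add: S_def sum_distrib_left sum_distrib_right distrib_left mult_ac)
    also have "\<dots> - (\<Sum>y\<in>UNIV. (t * A y z - \<tau>^2 * t^3 * (A y z - A y z * A z y)) * Q i y)
        = c * Q i z - (\<Sum>y\<in>UNIV. c * N i y z)"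
      unfolding key by (simp add: sum_subtractf)
    also have "\<dots> = c * (Q i z - (\<Sum>y\<in>UNIV. N i y z))" by (simp add: sum_distrib_left algebra_simps)
    also have "\<dots> = c * (if i = z then 1 else 0)" using Qeq[of i z] by simp
    finally show ?thesis .
  qed
  then show ?thesis
    by (simp add: vec_eq_iff matrix_matrix_mult_def mat_def Q_def c_def flip: \<tau>_def)
qed

section \<open>The recursion on edges\<close>

text \<open>Summing over all starting vertices makes the inhomogeneous term 1 on every edge, so that
  the generating function is at least \<open>t\<close> there. The contraction argument rests on
  this.\<close>

definition edge_weight :: "('n::finite \<times> 'n) set \<Rightarrow> real \<Rightarrow> nat \<Rightarrow> 'n \<Rightarrow> 'n \<Rightarrow> real" where
  "edge_weight E \<omega> k x y = (\<Sum>i\<in>UNIV. end_weight E \<omega> k i x y)"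

lemma edge_weight_0 [simp]: "edge_weight E \<omega> 0 x y = 0"
  by (simp add: edge_weight_def)

lemma edge_weight_nonneg: "0 \<le> \<omega> \<Longrightarrow> 0 \<le> edge_weight E \<omega> k x y"
  unfolding edge_weight_def by (intro sum_nonneg end_weight_nonneg)

lemma edge_weight_Suc:
  "edge_weight E \<omega> (Suc k) y z = (if (y, z) \<in> E then (if k = 0 then 1 else 0)
     + (\<Sum>x\<in>UNIV. (if x = z then \<omega> else 1) * edge_weight E \<omega> k x y) else 0)"
proof (cases "(y, z) \<in> E")
  case True
  have "edge_weight E \<omega> (Suc k) y z = (\<Sum>i\<in>UNIV. (if k = 0 \<and> i = y then 1 else 0)
      + (\<Sum>x\<in>UNIV. end_weight E \<omega> k i x y) - (1 - \<omega>) * end_weight E \<omega> k i z y)"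
    using True by (simp add: edge_weight_def end_weight_Suc qmat_end_weight)
  also have "\<dots> = (if k = 0 then 1 else 0) + (\<Sum>i\<in>UNIV. \<Sum>x\<in>UNIV. end_weight E \<omega> k i x y)
      - (1 - \<omega>) * edge_weight E \<omega> k z y"
    by (simp add: sum_subtractf sum.distrib edge_weight_def sum_distrib_left)
  also have "(\<Sum>i\<in>UNIV. \<Sum>x\<in>UNIV. end_weight E \<omega> k i x y) = (\<Sum>x\<in>UNIV. edge_weight E \<omega> k x y)"
    unfolding edge_weight_def by (rule sum.swap)
  \<comment> \<open>The correction moves into the summand \<open>x = z\<close>, where it turns the
    coefficient 1 into \<omega>.\<close>
  also have "(if k = 0 then 1 else 0) + (\<Sum>x\<in>UNIV. edge_weight E \<omega> k x y) - (1 - \<omega>) * edge_weight E \<omega> k z y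
      = (if k = 0 then 1 else 0) + (\<Sum>x\<in>UNIV. edge_weight E \<omega> k x y
          - (if x = z then (1 - \<omega>) * edge_weight E \<omega> k x y else 0))"
    by (simp add: sum_subtractf)
  also have "(\<Sum>x\<in>UNIV. edge_weight E \<omega> k x y - (if x = z then (1 - \<omega>) * edge_weight E \<omega> k x y else 0))
      = (\<Sum>x\<in>UNIV. (if x = z then \<omega> else 1) * edge_weight E \<omega> k x y)"
    by (intro sum.cong) (auto simp: algebra_simps)
  finally show ?thesis using True by simp
qed (simp add: edge_weight_def end_weight_Suc)

lemma qmat_le_edge_weight:
  assumes "0 \<le> \<omega>" "0 < k"
  shows "qmat E \<omega> k $ i $ y \<le> (\<Sum>x\<in>UNIV. edge_weight E \<omega> k x y)"
  using assms unfolding edge_weight_def qmat_end_weight[of E \<omega> k]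
  by (auto intro!: sum_mono member_le_sum end_weight_nonneg)

lemma summable_edge_weight:
  assumes "0 \<le> \<omega>" "0 \<le> t" "qmat_summable E \<omega> t"
  shows "summable (\<lambda>k. edge_weight E \<omega> k x y * t ^ k)"
  unfolding edge_weight_def sum_distrib_right by (intro summable_sum summable_end_weight assms)

definition edge_gen :: "('n::finite \<times> 'n) set \<Rightarrow> real \<Rightarrow> real \<Rightarrow> 'n \<Rightarrow> 'n \<Rightarrow> real" where
  "edge_gen E \<omega> t x y = (\<Sum>k. edge_weight E \<omega> k x y * t ^ k)"

lemma edge_gen_nonneg:
  assumes "0 \<le> \<omega>" "0 \<le> t" "qmat_summable E \<omega> t"
  shows "0 \<le> edge_gen E \<omega> t x y"
  unfolding edge_gen_def
  by (intro suminf_nonneg summable_edge_weight mult_nonneg_nonneg edge_weight_nonneg zero_le_power assms)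

lemma edge_gen_eq:
  assumes "0 \<le> \<omega>" "0 \<le> t" "qmat_summable E \<omega> t" "(y, z) \<in> E"
  shows "edge_gen E \<omega> t y z = t * (1 + (\<Sum>x\<in>UNIV. (if x = z then \<omega> else 1) * edge_gen E \<omega> t x y))"
proof -
  note sm = summable_edge_weight[OF assms(1-3)]
  have Suc: "(\<lambda>k. edge_weight E \<omega> (Suc k) y z * t ^ Suc k) sums edge_gen E \<omega> t y z"
    unfolding edge_gen_def by (subst sums_Suc_iff) (use summable_sums[OF sm[of y z]] in simp)
  have step: "edge_weight E \<omega> (Suc k) y z * t ^ Suc k = t * ((if k = 0 then 1 else 0) * t ^ k
      + (\<Sum>x\<in>UNIV. (if x = z then \<omega> else 1) * (edge_weight E \<omega> k x y * t ^ k)))" for k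
    using assms(4) by (simp add: edge_weight_Suc sum_distrib_left sum_distrib_right distrib_left distrib_right mult_ac)
  have "(\<lambda>k. t * ((if k = 0 then 1 else 0) * t ^ k
      + (\<Sum>x\<in>UNIV. (if x = z then \<omega> else 1) * (edge_weight E \<omega> k x y * t ^ k)))) sums
      edge_gen E \<omega> t y z"
    using Suc unfolding step .
  moreover have "(\<lambda>k. t * ((if k = 0 then 1 else 0) * t ^ k
      + (\<Sum>x\<in>UNIV. (if x = z then \<omega> else 1) * (edge_weight E \<omega> k x y * t ^ k)))) sums
      (t * (1 + (\<Sum>x\<in>UNIV. (if x = z then \<omega> else 1) * edge_gen E \<omega> t x y)))"
    unfolding edge_gen_def by (intro sums_mult sums_add sums_at_0 sums_sum summable_sums sm)
  ultimately show ?thesis by (rule sums_unique2)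
qed

subsection \<open>Growth of the weights\<close>

text \<open>The edge generating function u satisfies u = t (1 + B u) on the edges, where B is the transfer
  operator of the recursion. As u is bounded, t B u is at most a proper fraction of u; iterating this
  gives geometric decay of the coefficients with a ratio strictly below 1/t.\<close>

lemma qmat_summable_extend:
  assumes \<omega>: "0 \<le> \<omega>" and t: "0 < t" and sm: "qmat_summable E \<omega> t"
  shows "\<exists>s>t. qmat_summable E \<omega> s"
proof -
  define u where "u = edge_gen E \<omega> t"
  define \<kappa> where "\<kappa> x z = (if x = z then \<omega> else 1)" for x z :: 'a
  \<comment> \<open>\<open>U\<close> bounds every entry of \<open>u\<close> and exceeds
    \<open>t\<close>. Hence \<open>u - t\<close> is at most \<open>(1 - t / U) * u\<close>, with a
    factor strictly between 0 and 1.\<close>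
  define U where "U = t + 1 + (\<Sum>x\<in>UNIV. \<Sum>y\<in>UNIV. u x y)"
  define \<theta> where "\<theta> = 1 - t / U"
  have u0: "0 \<le> u x y" for x y unfolding u_def by (rule edge_gen_nonneg) (use \<omega> t sm in auto)
  have \<kappa>0: "0 \<le> \<kappa> x z" for x z using \<omega> by (simp add: \<kappa>_def)
  have UU: "t < U" "0 < U" using t u0 by (auto simp: U_def intro!: add_pos_nonneg sum_nonneg)
  then have \<theta>: "0 < \<theta>" "\<theta> < 1" using t by (auto simp: \<theta>_def)
  have uU: "u x y \<le> U" for x y
  proof -
    have "u x y \<le> (\<Sum>y\<in>UNIV. u x y)" by (rule member_le_sum) (use u0 in auto)
    also have "\<dots> \<le> (\<Sum>x\<in>UNIV. \<Sum>y\<in>UNIV. u x y)"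
      by (rule member_le_sum) (use u0 in \<open>auto intro: sum_nonneg\<close>)
    finally show ?thesis using t by (simp add: U_def)
  qed
  have ueq: "u y z = t * (1 + (\<Sum>x\<in>UNIV. \<kappa> x z * u x y))" if "(y, z) \<in> E" for y z
    unfolding u_def \<kappa>_def by (rule edge_gen_eq) (use \<omega> t sm that in auto)
  have contract: "t * (\<Sum>x\<in>UNIV. \<kappa> x z * u x y) \<le> \<theta> * u y z" if "(y, z) \<in> E" for y z
  proof -
    have "t * u y z \<le> t * U" using uU t by simp
    then have "u y z * t / U \<le> t" using UU by (simp add: field_simps)
    moreover have "t * (\<Sum>x\<in>UNIV. \<kappa> x z * u x y) = u y z - t"
      using ueq[OF that] by (simp add: distrib_left)
    moreover have "\<theta> * u y z = u y z - u y z * t / U" by (simp add: \<theta>_def algebra_simps)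
    ultimately show ?thesis by linarith
  qed
  have decay: "edge_weight E \<omega> (Suc k) y z * t ^ Suc k \<le> \<theta> ^ k * u y z" for k y z
  proof (cases "(y, z) \<in> E")
    case True
    then show ?thesis
    proof (induction k arbitrary: y z)
      case 0
      have "0 \<le> (\<Sum>x\<in>UNIV. \<kappa> x z * u x y)" using \<kappa>0 u0 by (intro sum_nonneg mult_nonneg_nonneg)
      then have "t * 1 \<le> t * (1 + (\<Sum>x\<in>UNIV. \<kappa> x z * u x y))" using t by (intro mult_left_mono) auto
      then have "t \<le> u y z" using ueq[OF 0] by simp
      then show ?case using 0 by (simp add: edge_weight_Suc)
    next
      case (Suc k)
      have IH: "edge_weight E \<omega> (Suc k) x y * t ^ Suc k \<le> \<theta> ^ k * u x y" for x
      proof (cases "(x, y) \<in> E")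
        case False
        then show ?thesis using \<theta> u0 by (simp add: edge_weight_Suc)
      qed (rule Suc.IH)
      have "edge_weight E \<omega> (Suc (Suc k)) y z * t ^ Suc (Suc k)
          = t * (\<Sum>x\<in>UNIV. \<kappa> x z * (edge_weight E \<omega> (Suc k) x y * t ^ Suc k))"
        using Suc.prems
        by (simp add: edge_weight_Suc[of E \<omega> "Suc k"] \<kappa>_def sum_distrib_left sum_distrib_right mult_ac)
      also have "\<dots> \<le> t * (\<Sum>x\<in>UNIV. \<kappa> x z * (\<theta> ^ k * u x y))"
        using t by (intro mult_left_mono sum_mono IH \<kappa>0) auto
      also have "\<dots> = \<theta> ^ k * (t * (\<Sum>x\<in>UNIV. \<kappa> x z * u x y))"
        by (simp add: sum_distrib_left mult_ac)
      also have "\<dots> \<le> \<theta> ^ k * (\<theta> * u y z)"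
        using \<theta> by (intro mult_left_mono contract Suc.prems) auto
      finally show ?case by (simp add: mult_ac)
    qed
  next
    case False
    then show ?thesis using \<theta> u0 by (simp add: edge_weight_Suc)
  qed
  \<comment> \<open>The factor \<open>2 / (1 + \<theta>)\<close> exceeds 1, yet its product with
    \<theta> stays below 1.\<close>
  define s where "s = t * (2 / (1 + \<theta>))"
  define \<rho> where "\<rho> = 2 / (1 + \<theta>) * \<theta>"
  have st: "t < s" using t \<theta> by (simp add: s_def field_simps)
  have \<rho>: "0 < \<rho>" "\<rho> < 1" using \<theta> by (auto simp: \<rho>_def field_simps)
  have "summable (\<lambda>k. qmat E \<omega> k $ i $ j * s ^ k)" for i j
  proof -
    have bound: "qmat E \<omega> (Suc k) $ i $ j * s ^ Suc k
        \<le> (2 / (1 + \<theta>) * (\<Sum>x\<in>UNIV. u x j)) * \<rho> ^ k" for k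
    proof -
      have "qmat E \<omega> (Suc k) $ i $ j * s ^ Suc k \<le> (\<Sum>x\<in>UNIV. edge_weight E \<omega> (Suc k) x j) * s ^ Suc k"
        using st t by (intro mult_right_mono qmat_le_edge_weight \<omega>) auto
      also have "\<dots> = (2 / (1 + \<theta>)) ^ Suc k * (\<Sum>x\<in>UNIV. edge_weight E \<omega> (Suc k) x j * t ^ Suc k)"
        by (simp only: s_def power_mult_distrib sum_distrib_right[symmetric] sum_distrib_left[symmetric] mult_ac)
      also have "\<dots> \<le> (2 / (1 + \<theta>)) ^ Suc k * (\<Sum>x\<in>UNIV. \<theta> ^ k * u x j)"
        using \<theta> by (intro mult_left_mono sum_mono decay) auto
      also have "\<dots> = (2 / (1 + \<theta>) * (\<Sum>x\<in>UNIV. u x j)) * \<rho> ^ k"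
        by (simp only: \<rho>_def power_mult_distrib power_Suc sum_distrib_left[symmetric] mult_ac)
      finally show ?thesis .
    qed
    have "summable (\<lambda>k. qmat E \<omega> (Suc k) $ i $ j * s ^ Suc k)"
    proof (rule summable_comparison_test')
      show "summable (\<lambda>k. (2 / (1 + \<theta>) * (\<Sum>x\<in>UNIV. u x j)) * \<rho> ^ k)"
        using \<rho> by (intro summable_mult summable_geometric) auto
      show "norm (qmat E \<omega> (Suc k) $ i $ j * s ^ Suc k) \<le> (2 / (1 + \<theta>) * (\<Sum>x\<in>UNIV. u x j)) * \<rho> ^ k" for k
        using bound[of k] qmat_nonneg[OF \<omega>, of E "Suc k" i j] st t by (simp add: abs_mult)
    qed
    then show ?thesis by (rule summable_Suc_iff[THEN iffD1])
  qed
  then show ?thesis using st unfolding qmat_summable_def by blast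
qed

text \<open>At most \<open>n ^ k\<close> walks with \<open>Suc k\<close> edges end in a given edge,
  each of weight at most 1. The radius of convergence is therefore positive.\<close>

lemma qmat_summable_pos:
  fixes E :: "('n::finite \<times> 'n) set"
  assumes \<omega>: "0 \<le> \<omega>" "\<omega> \<le> 1"
  shows "\<exists>s>0. qmat_summable E \<omega> s"
proof -
  define n where "n = real CARD('n)"
  have "0 < CARD('n)" by simp
  then have n: "1 \<le> n" unfolding n_def by linarith
  have bound: "edge_weight E \<omega> (Suc k) y z \<le> n ^ k" for k y z
  proof (induction k arbitrary: y z)
    case (Suc k)
    have "(\<Sum>x\<in>UNIV. (if x = z then \<omega> else 1) * edge_weight E \<omega> (Suc k) x y) \<le> (\<Sum>x\<in>(UNIV :: 'n set). 1 * n ^ k)"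
      using \<omega> n by (intro sum_mono mult_mono Suc.IH edge_weight_nonneg) auto
    then show ?case using n by (simp add: edge_weight_Suc[of E \<omega> "Suc k"] n_def)
  qed (simp add: edge_weight_Suc)
  \<comment> \<open>The remaining sum over the penultimate vertex gives \<open>n ^ Suc k\<close>, so
    this choice leaves a geometric series of ratio 1/2.\<close>
  define s where "s = 1 / (2 * n)"
  have s: "0 < s" using n by (simp add: s_def)
  have "summable (\<lambda>k. qmat E \<omega> k $ i $ j * s ^ k)" for i j
  proof -
    have "summable (\<lambda>k. qmat E \<omega> (Suc k) $ i $ j * s ^ Suc k)"
    proof (rule summable_comparison_test')
      show "summable (\<lambda>k. (1 / 2 :: real) ^ Suc k)" by (simp add: summable_geometric)
      show "norm (qmat E \<omega> (Suc k) $ i $ j * s ^ Suc k) \<le> (1 / 2) ^ Suc k" for k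
      proof -
        have "qmat E \<omega> (Suc k) $ i $ j \<le> (\<Sum>x\<in>UNIV. edge_weight E \<omega> (Suc k) x j)"
          by (rule qmat_le_edge_weight) (use \<omega> in auto)
        also have "\<dots> \<le> (\<Sum>x\<in>(UNIV :: 'n set). n ^ k)" by (intro sum_mono bound)
        also have "\<dots> = n ^ Suc k" by (simp add: n_def)
        finally have "qmat E \<omega> (Suc k) $ i $ j * s ^ Suc k \<le> n ^ Suc k * s ^ Suc k"
          using s by (intro mult_right_mono) auto
        also have "\<dots> = (1 / 2) ^ Suc k"
          unfolding power_mult_distrib[symmetric] s_def using n by simp
        finally show ?thesis using s qmat_nonneg[OF \<omega>(1), of E "Suc k" i j] by (simp add: abs_mult)
      qed
    qed
    then show ?thesis by (rule summable_Suc_iff[THEN iffD1])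
  qed
  then show ?thesis using s unfolding qmat_summable_def by blast
qed

section \<open>Divergence below 1 from a merging edge\<close>

text \<open>Predecessors other than the reversed edge enter with coefficient 1 and the remaining
  terms are nonnegative. The bounds thus do not depend on the weight of a backtracking step.\<close>

lemma edge_gen_ge_sum:
  assumes \<omega>: "0 \<le> \<omega>" and t: "0 \<le> t" and sm: "qmat_summable E \<omega> t"
    and E: "(y, z) \<in> E" and X: "z \<notin> X"
  shows "t * (\<Sum>x\<in>X. edge_gen E \<omega> t x y) \<le> edge_gen E \<omega> t y z" "t \<le> edge_gen E \<omega> t y z"
proof -
  note nonneg = edge_gen_nonneg[OF \<omega> t sm]
  let ?f = "\<lambda>x. (if x = z then \<omega> else 1) * edge_gen E \<omega> t x y"
  have "(\<Sum>x\<in>X. edge_gen E \<omega> t x y) = sum ?f X" using X by (intro sum.cong) auto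
  also have "\<dots> \<le> sum ?f UNIV" by (rule sum_mono2) (use nonneg \<omega> in auto)
  finally have *: "(\<Sum>x\<in>X. edge_gen E \<omega> t x y) \<le> sum ?f UNIV" .
  have "0 \<le> (\<Sum>x\<in>X. edge_gen E \<omega> t x y)" by (intro sum_nonneg nonneg)
  with * have "1 \<le> 1 + sum ?f UNIV" "(\<Sum>x\<in>X. edge_gen E \<omega> t x y) \<le> 1 + sum ?f UNIV" by linarith+
  from this[THEN mult_left_mono[OF _ t]]
  show "t * (\<Sum>x\<in>X. edge_gen E \<omega> t x y) \<le> edge_gen E \<omega> t y z" "t \<le> edge_gen E \<omega> t y z"
    unfolding edge_gen_eq[OF \<omega> t sm E] by simp_all
qed

text \<open>Each non-backtracking step costs one factor \<open>t\<close>. The exponent is chosen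
  before \<open>t\<close>, so that \<open>t\<close> can later tend to 1.\<close>

lemma edge_gen_reach:
  assumes "(e, f) \<in> (nb_step E)\<^sup>*" and \<omega>: "0 \<le> \<omega>"
  shows "\<exists>n. \<forall>t. 0 \<le> t \<longrightarrow> qmat_summable E \<omega> t \<longrightarrow>
    t ^ n * case_prod (edge_gen E \<omega> t) e \<le> case_prod (edge_gen E \<omega> t) f"
  using assms(1)
proof (induction rule: rtrancl_induct)
  case base
  show ?case by (rule exI[of _ 0]) simp
next
  case (step f g)
  from step.IH obtain n where n: "\<And>t. 0 \<le> t \<Longrightarrow> qmat_summable E \<omega> t \<Longrightarrow>
    t ^ n * case_prod (edge_gen E \<omega> t) e \<le> case_prod (edge_gen E \<omega> t) f" by blast
  obtain x y z where fg: "f = (x, y)" "g = (y, z)" "(y, z) \<in> E" "z \<noteq> x"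
    using step.hyps(2) by (auto simp: nb_step_def)
  have "t ^ Suc n * case_prod (edge_gen E \<omega> t) e \<le> case_prod (edge_gen E \<omega> t) g"
    if t: "0 \<le> t" "qmat_summable E \<omega> t" for t
  proof -
    have "t * (t ^ n * case_prod (edge_gen E \<omega> t) e) \<le> t * case_prod (edge_gen E \<omega> t) f"
      using n[OF t] t(1) by (rule mult_left_mono)
    also have "\<dots> \<le> case_prod (edge_gen E \<omega> t) g"
      using edge_gen_ge_sum(1)[OF \<omega> t fg(3), of "{x}"] fg by simp
    finally show ?thesis by (simp add: mult_ac)
  qed
  then show ?case by blast
qed

lemma nb_merging_not_summable:
  assumes \<omega>: "0 \<le> \<omega>" and merging: "nb_merging E"
  shows "\<exists>t. 0 < t \<and> t < 1 \<and> \<not> qmat_summable E \<omega> t"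
proof (rule ccontr)
  assume "\<not> ?thesis"
  then have sm: "\<And>t. 0 < t \<Longrightarrow> t < 1 \<Longrightarrow> qmat_summable E \<omega> t" by blast
  from merging obtain e g1 g2 where e: "g1 \<noteq> g2" "(g1, e) \<in> nb_step E" "(g2, e) \<in> nb_step E"
    "(e, g1) \<in> (nb_step E)\<^sup>*" "(e, g2) \<in> (nb_step E)\<^sup>*" unfolding nb_merging_def by blast
  from e(1-3) obtain x1 x2 y z where g: "g1 = (x1, y)" "g2 = (x2, y)" "e = (y, z)"
    "(y, z) \<in> E" "x1 \<noteq> x2" "z \<noteq> x1" "z \<noteq> x2" by (auto simp: nb_step_def)
  obtain a b where ab: "\<And>t. 0 \<le> t \<Longrightarrow> qmat_summable E \<omega> t \<Longrightarrow> t ^ a * edge_gen E \<omega> t y z \<le> edge_gen E \<omega> t x1 y"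
    "\<And>t. 0 \<le> t \<Longrightarrow> qmat_summable E \<omega> t \<Longrightarrow> t ^ b * edge_gen E \<omega> t y z \<le> edge_gen E \<omega> t x2 y"
    using edge_gen_reach[OF e(4) \<omega>] edge_gen_reach[OF e(5) \<omega>] unfolding g by auto
  have le: "t ^ Suc a + t ^ Suc b \<le> 1" if t: "0 < t" "t < 1" for t :: real
  proof -
    let ?u = "edge_gen E \<omega> t y z"
    have t0: "0 \<le> t" using t by simp
    have "(t ^ Suc a + t ^ Suc b) * ?u = t * (t ^ a * ?u + t ^ b * ?u)" by (simp add: algebra_simps)
    also have "\<dots> \<le> t * (edge_gen E \<omega> t x1 y + edge_gen E \<omega> t x2 y)"
      using ab[OF t0 sm[OF t]] t by (intro mult_left_mono add_mono) auto
    also have "\<dots> \<le> ?u" using edge_gen_ge_sum(1)[OF \<omega> t0 sm[OF t] g(4), of "{x1, x2}"] g by simp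
    finally have "(t ^ Suc a + t ^ Suc b) * ?u \<le> 1 * ?u" by simp
    moreover have "0 < ?u" using edge_gen_ge_sum(2)[OF \<omega> t0 sm[OF t] g(4), of "{}"] t by simp
    ultimately show ?thesis by (rule mult_right_le_imp_le)
  qed
  \<comment> \<open>As \<open>t\<close> tends to 1 from below, the sum of the two powers tends to 2,
    against the bound 1.\<close>
  have "((\<lambda>t. t ^ Suc a + t ^ Suc b) \<longlongrightarrow> 1 ^ Suc a + 1 ^ Suc b) (at_left (1 :: real))"
    by (intro tendsto_intros)
  moreover have "eventually (\<lambda>t::real. t ^ Suc a + t ^ Suc b \<le> 1) (at_left 1)"
    using eventually_at_left_real[OF zero_less_one] by eventually_elim (use le in auto)
  ultimately have "(1 :: real) ^ Suc a + 1 ^ Suc b \<le> 1"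
    by (rule tendsto_upperbound) simp
  then show False by simp
qed

section \<open>Radius of convergence and zeros of the determinant\<close>

lemma qmat_summable_below_conv_radius:
  assumes "0 \<le> \<omega>" "0 \<le> t" "ereal t < conv_radius (qmat E \<omega>)"
  shows "qmat_summable E \<omega> t"
  unfolding qmat_summable_def
proof (intro allI)
  fix i j
  have "summable (\<lambda>k. norm (qmat E \<omega> k) * t ^ k)"
    by (rule summable_in_conv_radius) (use assms in simp)
  moreover have "norm (qmat E \<omega> k $ i $ j * t ^ k) \<le> norm (qmat E \<omega> k) * t ^ k" for k
    using Finite_Cartesian_Product.norm_nth_le[of "qmat E \<omega> k $ i" j]
      Finite_Cartesian_Product.norm_nth_le[of "qmat E \<omega> k" i] assms(2)
    by (auto simp: abs_mult intro!: mult_right_mono)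
  ultimately show "summable (\<lambda>k. qmat E \<omega> k $ i $ j * t ^ k)" by (rule summable_comparison_test')
qed

text \<open>The norm of a matrix with nonnegative entries is at most the sum of its entries.\<close>

lemma conv_radius_ge_if_qmat_summable:
  assumes "0 \<le> \<omega>" "0 \<le> t" "qmat_summable E \<omega> t"
  shows "ereal t \<le> conv_radius (qmat E \<omega>)"
proof -
  have "summable (\<lambda>k. norm (qmat E \<omega> k) * t ^ k)"
  proof (rule summable_comparison_test')
    show "summable (\<lambda>k. \<Sum>i\<in>UNIV. \<Sum>j\<in>UNIV. qmat E \<omega> k $ i $ j * t ^ k)"
      using assms(3) by (intro summable_sum) (simp add: qmat_summable_def)
    fix k
    have "norm (qmat E \<omega> k) \<le> (\<Sum>i\<in>UNIV. norm (qmat E \<omega> k $ i))"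
      unfolding norm_vec_def[of "qmat E \<omega> k"] by (rule L2_set_le_sum) simp
    also have "\<dots> \<le> (\<Sum>i\<in>UNIV. \<Sum>j\<in>UNIV. qmat E \<omega> k $ i $ j)"
      by (intro sum_mono order_trans[OF norm_le_l1_cart]) (simp add: qmat_nonneg[OF assms(1)])
    finally show "norm (norm (qmat E \<omega> k) * t ^ k) \<le> (\<Sum>i\<in>UNIV. \<Sum>j\<in>UNIV. qmat E \<omega> k $ i $ j * t ^ k)"
      using assms(2) by (simp add: abs_mult sum_distrib_right[symmetric] mult_right_mono)
  qed
  from conv_radius_geI[OF this] show ?thesis using assms(2) by simp
qed

lemma tendsto_det:
  fixes A :: "'b \<Rightarrow> real^'n::finite^'n"
  assumes "\<And>i j. ((\<lambda>t. A t $ i $ j) \<longlongrightarrow> B $ i $ j) F"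
  shows "((\<lambda>t. det (A t)) \<longlongrightarrow> det B) F"
  unfolding det_def by (intro tendsto_intros assms)

lemma Mtau_tendsto: "((\<lambda>t. Mtau E \<tau> t $ i $ j) \<longlongrightarrow> Mtau E \<tau> r $ i $ j) (at r within S)"
  unfolding Mtau_def by (simp, intro tendsto_intros)

text \<open>Where the scalar factor does not vanish, the rescaled generating matrix is a left
  inverse.\<close>

lemma det_Mtau_nonzero:
  assumes "0 \<le> \<omega>" "0 \<le> t" "qmat_summable E \<omega> t" "(1 - \<omega>)^2 * t^2 \<noteq> 1"
  shows "det (Mtau E (1 - \<omega>) t) \<noteq> 0"
proof -
  define c where "c = 1 - (1 - \<omega>)^2 * t^2"
  have "c \<noteq> 0" using assms(4) by (simp add: c_def)
  have "qmat_gen E \<omega> t ** Mtau E (1 - \<omega>) t = c *\<^sub>R mat 1"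
    using qmat_gen_times_Mtau[OF assms(1-3)] by (simp add: c_def)
  then have "((1 / c) *\<^sub>R qmat_gen E \<omega> t) ** Mtau E (1 - \<omega>) t = mat 1"
    using \<open>c \<noteq> 0\<close> by (simp add: scalar_matrix_assoc[symmetric])
  then show ?thesis unfolding invertible_det_nz[symmetric] invertible_left_inverse by blast
qed

text \<open>By Cramer's rule the entries of the generating function are quotients by det M(t), hence stay
  bounded on approach to a point where the determinant does not vanish.\<close>

lemma qmat_summable_at_regular_point:
  assumes \<omega>: "0 \<le> \<omega>" and r: "0 < r" and sm: "\<And>t. 0 < t \<Longrightarrow> t < r \<Longrightarrow> qmat_summable E \<omega> t"
    and det: "det (Mtau E (1 - \<omega>) r) \<noteq> 0"
  shows "qmat_summable E \<omega> r"
  unfolding qmat_summable_def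
proof (intro allI)
  fix i j
  let ?M = "Mtau E (1 - \<omega>)"
  define c where "c t = 1 - (1 - \<omega>)^2 * t^2" for t
  \<comment> \<open>This is the numerator matrix of Cramer's rule: row \<open>j\<close> of
    \<open>M\<close> is replaced by row \<open>i\<close> of the right-hand side. Rows appear because
    the unknown multiplies \<open>M\<close> from the left.\<close>
  define D where "D t = (\<chi> a b. if a = j then c t * (mat 1 $ i $ b) else ?M t $ a $ b)" for t
  have cramer: "qmat_gen E \<omega> t $ i $ j * det (?M t) = det (D t)" if "0 < t" "t < r" for t
  proof -
    have row: "(\<Sum>a\<in>UNIV. qmat_gen E \<omega> t $ i $ a *s row a (?M t)) $ b = c t * mat 1 $ i $ b" for b
    proof -
      have "(\<Sum>a\<in>UNIV. qmat_gen E \<omega> t $ i $ a *s row a (?M t)) $ b = (qmat_gen E \<omega> t ** ?M t) $ i $ b"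
        by (simp add: matrix_matrix_mult_def row_def)
      also have "\<dots> = c t * mat 1 $ i $ b"
        using qmat_gen_times_Mtau[OF \<omega> _ sm[OF that]] that by (simp add: c_def)
      finally show ?thesis .
    qed
    have "(\<chi> a. if a = j then \<Sum>a\<in>UNIV. qmat_gen E \<omega> t $ i $ a *s row a (?M t) else row a (?M t)) = D t"
      unfolding vec_eq_iff D_def using row by (simp add: row_def)
    then show ?thesis using cramer_lemma_transpose[of j "qmat_gen E \<omega> t $ i" "?M t"] by simp
  qed
  have limD: "((\<lambda>t. det (D t)) \<longlongrightarrow> det (D r)) (at_left r)"
  proof (rule tendsto_det)
    fix a b
    show "((\<lambda>t. D t $ a $ b) \<longlongrightarrow> D r $ a $ b) (at_left r)"
      by (cases "a = j") (auto simp: D_def c_def intro!: tendsto_intros Mtau_tendsto)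
  qed
  have limM: "((\<lambda>t. det (?M t)) \<longlongrightarrow> det (?M r)) (at_left r)"
    by (intro tendsto_det Mtau_tendsto)
  have lim: "((\<lambda>t. det (D t) / det (?M t)) \<longlongrightarrow> det (D r) / det (?M r)) (at_left r)"
    by (intro tendsto_divide limD limM det)
  have ev: "eventually (\<lambda>t. t \<in> {0<..<r} \<and> det (?M t) \<noteq> 0) (at_left r)"
    using eventually_at_left_real[OF r] tendsto_imp_eventually_ne[OF limM det] by eventually_elim simp
  \<comment> \<open>For fixed \<open>n\<close> the bound on the partial sum passes to the limit at
    \<open>r\<close>; its limit does not depend on \<open>n\<close>, so the nonnegative series
    converges.\<close>
  have "(\<Sum>k<n. qmat E \<omega> k $ i $ j * r ^ k) \<le> det (D r) / det (?M r)" for n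
  proof (rule tendsto_le[OF _ lim])
    show "((\<lambda>t. \<Sum>k<n. qmat E \<omega> k $ i $ j * t ^ k) \<longlongrightarrow> (\<Sum>k<n. qmat E \<omega> k $ i $ j * r ^ k)) (at_left r)"
      by (intro tendsto_intros)
    show "eventually (\<lambda>t. (\<Sum>k<n. qmat E \<omega> k $ i $ j * t ^ k) \<le> det (D t) / det (?M t)) (at_left r)"
      using ev
    proof eventually_elim
      case (elim t)
      then have t: "0 < t" "t < r" by auto
      have "(\<Sum>k<n. qmat E \<omega> k $ i $ j * t ^ k) \<le> qmat_gen E \<omega> t $ i $ j"
        unfolding qmat_gen_def using sm[OF t] t
        by (auto intro!: sum_le_suminf mult_nonneg_nonneg qmat_nonneg[OF \<omega>] simp: qmat_summable_def)
      also have "\<dots> = det (D t) / det (?M t)" using cramer[OF t] elim by (simp add: field_simps)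
      finally show ?case .
    qed
  qed simp
  then show "summable (\<lambda>k. qmat E \<omega> k $ i $ j * r ^ k)"
    by (intro summableI_nonneg_bounded mult_nonneg_nonneg qmat_nonneg[OF \<omega>] zero_le_power) (use r in auto)
qed

theorem theorem4p14:
  fixes E :: "('n::finite \<times> 'n) set" and \<omega> \<tau> \<mu> :: real
  assumes noloops: "\<forall>i. (i, i) \<notin> E"
    and om: "0 \<le> \<omega>" "\<omega> < 1"
    and tau: "\<tau> = 1 - \<omega>"
    and mu: "0 < \<mu>" "det (Mtau E \<tau> \<mu>) = 0"
            "\<forall>t. 0 < t \<and> t < \<mu> \<longrightarrow> det (Mtau E \<tau> t) \<noteq> 0"
    and cyc: "\<exists>C\<in>components E. more_than_one_cycle (und_adj E C)"
  shows "conv_radius (qmat E \<omega>) = ereal \<mu> \<and> \<mu> < 1 / \<tau>"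
proof -
  let ?R = "conv_radius (qmat E \<omega>)"
  have "nb_merging E" using nb_merging_if_more_than_one_cycle[OF noloops] cyc by blast
  from nb_merging_not_summable[OF om(1) this] obtain t1 where
    t1: "0 < t1" "t1 < 1" "\<not> qmat_summable E \<omega> t1" by blast
  then have "?R \<le> ereal t1" using qmat_summable_below_conv_radius[OF om(1), of t1 E] by force
  moreover obtain t0 where t0: "0 < t0" "qmat_summable E \<omega> t0" using qmat_summable_pos[of \<omega> E] om by auto
  then have "ereal t0 \<le> ?R" using conv_radius_ge_if_qmat_summable[OF om(1), of t0 E] by simp
  ultimately obtain r where R: "?R = ereal r" and r: "0 < r" "r < 1"
    using t0 t1 by (cases ?R) auto
  have sm: "qmat_summable E \<omega> t" if "0 < t" "t < r" for t
    using qmat_summable_below_conv_radius[OF om(1), of t E] R that by simp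
  have "det (Mtau E \<tau> t) \<noteq> 0" if "0 < t" "t < r" for t
  proof -
    have "\<tau> * t \<le> 1 * t" using om tau that by (intro mult_right_mono) auto
    then have "\<tau> * t < 1" using that r by linarith
    moreover have "0 \<le> \<tau> * t" using that om tau by simp
    ultimately have "(\<tau> * t)^2 < 1" by (simp add: power_less_one_iff)
    then show ?thesis
      using det_Mtau_nonzero[OF om(1) _ sm[OF that]] that tau by (simp add: power_mult_distrib)
  qed
  then have "r \<le> \<mu>" using mu by force
  \<comment> \<open>A nonzero determinant would give convergence at \<open>r\<close> and then beyond
    it, past the radius of convergence.\<close>
  moreover have "det (Mtau E \<tau> r) = 0"
  proof (rule ccontr)
    assume "det (Mtau E \<tau> r) \<noteq> 0"
    then have "qmat_summable E \<omega> r"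
      using qmat_summable_at_regular_point[OF om(1) r(1) sm] tau by blast
    from qmat_summable_extend[OF om(1) r(1) this] obtain s where "r < s" "qmat_summable E \<omega> s" by blast
    then show False using conv_radius_ge_if_qmat_summable[OF om(1), of s E] r R by simp
  qed
  then have "\<mu> \<le> r" using mu r by force
  moreover have "1 \<le> 1 / \<tau>" using om tau by simp
  ultimately show ?thesis using R r by auto
qed

end
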